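(* Let $R \subseteq \mathcal{O}(7)$ be a 3-dimensional space of quadratic relations, and let $\mathcal{I} = (R)$ be the operad ideal it generates. Then the rank $r = \dim \mathcal{I}(10)$ of the cubic consequences is either 21 or 22. The following is a complete list of triples of relations (spanning $R$) for which the rank achieves the minimal value of 21, where $\alpha \in \mathbb{F}$ denotes a primitive 6th root of unity ($\alpha^2-\alpha+1=0$): (1a) $\rho_1 = \phi\circ_1\phi$, $\rho_2 = \phi\circ_2\phi$, $\rho_3 = \phi\circ_3\phi$; (1b) $\rho_1 = \phi\circ_1\phi - \phi\circ_4\phi$, $\rho_2 = \phi\circ_2\phi$, $\rho_3 = \phi\circ_3\phi$; (1c) $\rho_1 = \phi\circ_1\phi - \phi\circ_4\phi$, $\rho_2 = \phi\circ_2\phi - \phi\circ_4\phi$, $\rho_3 = \phi\circ_3\phi - \phi\circ_4\phi$; (1d) $\rho_1 = \phi\circ_1\phi - \phi\circ_4\phi$, $\rho_2 = \phi\circ_2\phi + \alpha\,\phi\circ_4\phi$, $\rho_3 = \phi\circ_3\phi + \alpha^{-1}\phi\circ_4\phi$; (2) $\rho_1 = \phi\circ_1\phi$, $\rho_2 = \phi\circ_2\phi$, $\rho_3 = \phi\circ_4\phi$; (3) $\rho_1 = \phi\circ_1\phi$, $\rho_2 = \phi\circ_3\phi$, $\rho_3 = \phi\circ_4\phi$; (4) $\rho_1 = \phi\circ_2\phi$, $\rho_2 = \phi\circ_3\phi$, $\rho_3 = \phi\circ_4\phi$. In all other cases (i.e. when $R$ is not the span of one of these triples), the rank is 22 and the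 operad $\mathcal{O}/\mathcal{I}$ is nilpotent of index 3.
   Context: $\mathbb{F}$ is an algebraically closed field of characteristic 0. $\mathcal{O}$ is the free nonsymmetric operad over $\mathbb{F}$ generated by one quaternary operation $\phi$ (of homological degree 0): $\mathcal{O}(k)$ is the vector space with basis the complete rooted planar 4-ary trees with $k$ leaves (each internal node, labelled $\phi$, has exactly 4 children), and for trees $\alpha,\beta$ of arities $k,\ell$ and $1 \le i \le k$, $\alpha \circ_i \beta$ is the tree of arity $k+\ell-1$ obtained by substituting the root of $\beta$ for the $i$-th leaf of $\alpha$ (leaves counted from left to right), extended bilinearly. $\mathcal{O}(7)$ has basis $\phi\circ_i\phi$ ($1 \le i \le 4$). $\mathcal{O}(10)$ has dimension 22, with basis $\phi \circ_i (\phi \circ_j \phi)$ ($1 \le i,j \le 4$) and $(\phi \circ_j \phi) \circ_i \phi$ ($1 \le i < j \le 4$). The operad ideal $\mathcal{I} = (R)$ generated by a subspace $R \subseteq \mathcal{O}(7)$ is the smallest subspace of $\mathcal{O}$ containing $R$ and closed under left and right compositions by arbitrary elements of $\mathcal{O}$; $\mathcal{I}(10) = \mathcal{I} \cap \mathcal{O}(10)$ is spanned by the cubic consequences $\rho \circ_i \phi$ ($1 \le i \le 7$) and $\phi \circ_j \rho$ ($1 \le j \le 4$) of the elements $\rho$ of a basis of $R$. The quotient operad $\mathcal{Q} = \mathcal{O}/\mathcal{I}$ is nilpotent of index 3 if every tree monomial involving three occurrences of $\phi$ is zero in $\mathcal{Q}$ (i.e. $\mathcal{I}(10) = \mathcal{O}(10)$)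 but not every tree monomial involving two occurrences of $\phi$ is zero. *)

theory Defs
  imports "HOL-Library.Poly_Mapping" "HOL-Computational_Algebra.Polynomial"
begin

datatype tree = Leaf | Node tree tree tree tree

fun leaves :: "tree \<Rightarrow> nat" where
  "leaves Leaf = 1"
| "leaves (Node a b c d) = leaves a + leaves b + leaves c + leaves d"

fun nodes :: "tree \<Rightarrow> nat" where
  "nodes Leaf = 0"
| "nodes (Node a b c d) = Suc (nodes a + nodes b + nodes c + nodes d)"

text \<open>
  Substitution of \<open>t\<close> for the \<open>i\<close>-th leaf, counted from left to right starting with 1.
  The index is shifted past each subtree by truncated subtraction, so that it is 0 in
  every subtree to the right of the selected leaf; an index outside
  \<open>{1..leaves s}\<close> leaves the tree \<open>s\<close> unchanged.
\<close>
fun graft :: "tree \<Rightarrow> nat \<Rightarrow> tree \<Rightarrow> tree" where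
  "graft Leaf i t = (if i = 1 then t else Leaf)"
| "graft (Node a b c d) i t =
    Node (graft a i t)
         (graft b (i - leaves a) t)
         (graft c (i - leaves a - leaves b) t)
         (graft d (i - leaves a - leaves b - leaves c) t)"

lemma leaves_pos: "0 < leaves t"
  by (induction t) auto

lemma graft_outside: "i = 0 \<or> leaves s < i \<Longrightarrow> graft s i t = s"
  by (induction s arbitrary: i) auto

lemma leaves_graft:
  "1 \<le> i \<Longrightarrow> i \<le> leaves s \<Longrightarrow> leaves (graft s i t) = leaves s + leaves t - 1"
proof (induction s arbitrary: i)
  case Leaf
  then show ?case by simp
next
  case (Node a b c d)
  note pos = leaves_pos[of a] leaves_pos[of b] leaves_pos[of c] leaves_pos[of d] leaves_pos[of t]
  consider "i \<le> leaves a"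
    | "leaves a < i" "i \<le> leaves a + leaves b"
    | "leaves a + leaves b < i" "i \<le> leaves a + leaves b + leaves c"
    | "leaves a + leaves b + leaves c < i" "i \<le> leaves a + leaves b + leaves c + leaves d"
    using Node.prems by fastforce
  then show ?case
  proof cases
    case 1
    then show ?thesis using Node.IH(1)[of i] Node.prems pos by (simp add: graft_outside)
  next
    case 2
    then show ?thesis using Node.IH(2)[of "i - leaves a"] pos by (simp add: graft_outside)
  next
    case 3
    then show ?thesis using Node.IH(3)[of "i - leaves a - leaves b"] pos
      by (simp add: graft_outside)
  next
    case 4
    then show ?thesis using Node.IH(4)[of "i - leaves a - leaves b - leaves c"] pos
      by (simp add: graft_outside)
  qed
qed

text \<open>
  The free vector space on all trees, i.e. the direct sum of all components of the
  free operad, is the type of finitely supported functions \<open>tree \<Rightarrow>\<^sub>0 'a\<close>.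
\<close>
definition scale :: "'a::field \<Rightarrow> (tree \<Rightarrow>\<^sub>0 'a) \<Rightarrow> (tree \<Rightarrow>\<^sub>0 'a)" where
  "scale c = Poly_Mapping.map ((*) c)"

lemma lookup_scale: "Poly_Mapping.lookup (scale c f) t = c * Poly_Mapping.lookup f t"
  by (simp add: scale_def Poly_Mapping.map.rep_eq when_def)

global_interpretation operad: vector_space "scale :: 'a::field \<Rightarrow> (tree \<Rightarrow>\<^sub>0 'a) \<Rightarrow> _"
  by unfold_locales
    (simp_all add: poly_mapping_eq_iff fun_eq_iff lookup_scale lookup_add algebra_simps)

definition monomial :: "tree \<Rightarrow> (tree \<Rightarrow>\<^sub>0 'a::field)" where
  "monomial t = Poly_Mapping.single t 1"

definition component :: "nat \<Rightarrow> (tree \<Rightarrow>\<^sub>0 'a::field) set" where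
  "component k = {f. \<forall>t\<in>Poly_Mapping.keys f. leaves t = k}"

definition partial_comp ::
    "(tree \<Rightarrow>\<^sub>0 'a::field) \<Rightarrow> nat \<Rightarrow> (tree \<Rightarrow>\<^sub>0 'a) \<Rightarrow> (tree \<Rightarrow>\<^sub>0 'a)"
    ("(_ \<circ>[_] _)" [71, 0, 71] 70) where
  "f \<circ>[i] g =
    (\<Sum>s\<in>Poly_Mapping.keys f. \<Sum>t\<in>Poly_Mapping.keys g.
      scale (Poly_Mapping.lookup f s * Poly_Mapping.lookup g t) (monomial (graft s i t)))"

definition phi :: "tree \<Rightarrow>\<^sub>0 'a::field" where
  "phi = monomial (Node Leaf Leaf Leaf Leaf)"

text \<open>
  An ideal is a graded subspace, given here by its homogeneous components \<open>J k\<close>.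
\<close>
definition operad_ideal :: "(nat \<Rightarrow> (tree \<Rightarrow>\<^sub>0 'a::field) set) \<Rightarrow> bool" where
  "operad_ideal J \<longleftrightarrow>
    (\<forall>k. operad.subspace (J k) \<and> J k \<subseteq> component k) \<and>
    (\<forall>k l i. \<forall>f\<in>J k. \<forall>g\<in>component l. 1 \<le> i \<and> i \<le> k \<longrightarrow> f \<circ>[i] g \<in> J (k + l - 1)) \<and>
    (\<forall>k l i. \<forall>f\<in>component k. \<forall>g\<in>J l. 1 \<le> i \<and> i \<le> k \<longrightarrow> f \<circ>[i] g \<in> J (k + l - 1))"

definition generated_ideal ::
    "(tree \<Rightarrow>\<^sub>0 'a::field) set \<Rightarrow> nat \<Rightarrow> (tree \<Rightarrow>\<^sub>0 'a) set" where
  "generated_ideal S k =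
    \<Inter>{J k | J. operad_ideal J \<and> (\<forall>m. S \<inter> component m \<subseteq> J m)}"

text \<open>
  The class of an element \<open>f\<close> of arity \<open>k\<close> in the quotient of the free operad by the ideal \<open>J\<close>.
\<close>
definition quotient_class ::
    "(nat \<Rightarrow> (tree \<Rightarrow>\<^sub>0 'a::field) set) \<Rightarrow> nat \<Rightarrow> (tree \<Rightarrow>\<^sub>0 'a) \<Rightarrow> (tree \<Rightarrow>\<^sub>0 'a) set" where
  "quotient_class J k f = {g \<in> component k. g - f \<in> J k}"

definition zero_in_quotient :: "(nat \<Rightarrow> (tree \<Rightarrow>\<^sub>0 'a::field) set) \<Rightarrow> tree \<Rightarrow> bool" where
  "zero_in_quotient J t \<longleftrightarrow>
    quotient_class J (leaves t) (monomial t) = quotient_class J (leaves t) 0"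

definition quotient_nilpotent_of_index ::
    "(nat \<Rightarrow> (tree \<Rightarrow>\<^sub>0 'a::field) set) \<Rightarrow> nat \<Rightarrow> bool" where
  "quotient_nilpotent_of_index J n \<longleftrightarrow>
    (\<forall>t. nodes t = n \<longrightarrow> zero_in_quotient J t) \<and>
    \<not> (\<forall>t. nodes t = n - 1 \<longrightarrow> zero_in_quotient J t)"

definition primitive_root_of_unity :: "nat \<Rightarrow> 'a::field \<Rightarrow> bool" where
  "primitive_root_of_unity n \<alpha> \<longleftrightarrow> \<alpha> ^ n = 1 \<and> (\<forall>k. 0 < k \<and> k < n \<longrightarrow> \<alpha> ^ k \<noteq> 1)"

lemma primitive_6th_root_iff:
  fixes \<alpha> :: "'a::field_char_0"
  shows "primitive_root_of_unity 6 \<alpha> \<longleftrightarrow> \<alpha>\<^sup>2 - \<alpha> + 1 = 0"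
proof
  assume prim: "primitive_root_of_unity 6 \<alpha>"
  then have "\<alpha> ^ 6 = 1" and "\<alpha> ^ 3 \<noteq> 1" and "\<alpha> ^ 2 \<noteq> 1"
    by (auto simp: primitive_root_of_unity_def)
  moreover have "\<alpha> ^ 6 - 1 = (\<alpha> ^ 3 - 1) * (\<alpha> + 1) * (\<alpha>\<^sup>2 - \<alpha> + 1)"
    by algebra
  moreover have "\<alpha> + 1 \<noteq> 0"
  proof
    assume "\<alpha> + 1 = 0"
    then have "\<alpha> ^ 2 = 1" by algebra
    with \<open>\<alpha> ^ 2 \<noteq> 1\<close> show False ..
  qed
  ultimately show "\<alpha>\<^sup>2 - \<alpha> + 1 = 0" by auto
next
  assume root: "\<alpha>\<^sup>2 - \<alpha> + 1 = 0"
  then have cube: "\<alpha> ^ 3 = - 1" and sq: "\<alpha> ^ 2 = \<alpha> - 1" by algebra+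
  have "\<alpha> \<noteq> 1" "\<alpha> \<noteq> -1" "\<alpha> \<noteq> 2" using root by auto
  have "\<alpha> ^ k \<noteq> 1" if "0 < k" "k < 6" for k
  proof -
    from that consider "k = 1" | "k = 2" | "k = 3" | "k = 4" | "k = 5" by linarith
    then show ?thesis
    proof cases
      case 1
      then show ?thesis using \<open>\<alpha> \<noteq> 1\<close> by simp
    next
      case 2
      then show ?thesis using sq \<open>\<alpha> \<noteq> 2\<close> by (auto simp: algebra_simps)
    next
      case 3
      then show ?thesis using cube by simp
    next
      case 4
      have "\<alpha> ^ 4 = - \<alpha>" using cube by algebra
      then show ?thesis using 4 \<open>\<alpha> \<noteq> -1\<close> by (metis minus_minus)
    next
      case 5
      have "\<alpha> ^ 5 = 1 - \<alpha>" using cube sq by algebra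
      moreover have "\<alpha> \<noteq> 0" using root by auto
      ultimately show ?thesis using 5 by simp
    qed
  qed
  moreover have "\<alpha> ^ 6 = 1" using cube by algebra
  ultimately show "primitive_root_of_unity 6 \<alpha>" by (simp add: primitive_root_of_unity_def)
qed

text \<open>
  The last family contributes one triple for each of the two primitive sixth roots of unity.
\<close>
definition minimal_triples :: "(tree \<Rightarrow>\<^sub>0 'a::field) set set" where
  "minimal_triples =
    { {phi \<circ>[1] phi, phi \<circ>[2] phi, phi \<circ>[3] phi},
      {phi \<circ>[1] phi - phi \<circ>[4] phi, phi \<circ>[2] phi, phi \<circ>[3] phi},
      {phi \<circ>[1] phi - phi \<circ>[4] phi, phi \<circ>[2] phi - phi \<circ>[4] phi,
       phi \<circ>[3] phi - phi \<circ>[4] phi},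
      {phi \<circ>[1] phi, phi \<circ>[2] phi, phi \<circ>[4] phi},
      {phi \<circ>[1] phi, phi \<circ>[3] phi, phi \<circ>[4] phi},
      {phi \<circ>[2] phi, phi \<circ>[3] phi, phi \<circ>[4] phi} } \<union>
    { {phi \<circ>[1] phi - phi \<circ>[4] phi, phi \<circ>[2] phi + scale \<alpha> (phi \<circ>[4] phi),
       phi \<circ>[3] phi + scale (inverse \<alpha>) (phi \<circ>[4] phi)} | \<alpha>.
      primitive_root_of_unity 6 \<alpha> }"

end

theory Submission
  imports Defs
begin

text \<open>
  A 3-dimensional \<open>R\<close> is the kernel of a coefficient vector \<open>l\<close> on \<open>\<phi> \<circ>\<^sub>1 \<phi>, \<dots>, \<phi> \<circ>\<^sub>4 \<phi>\<close>, normalised so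
  that its first nonzero entry is \<open>l p = 1\<close>. A functional \<open>g\<close> on the 22 cubic trees kills all cubic
  consequences iff each of the eleven vectors of values at \<open>(\<phi> \<circ>\<^sub>k \<phi>) \<circ>\<^sub>j \<phi>\<close> and \<open>\<phi> \<circ>\<^sub>i (\<phi> \<circ>\<^sub>k \<phi>)\<close>,
  \<open>k = 1, \<dots>, 4\<close>, is a multiple of \<open>l\<close>. Since every nested tree arises in two of these ways, the value
  at \<open>\<phi> \<circ>\<^sub>i (\<phi> \<circ>\<^sub>k \<phi>)\<close> is \<open>l k * (l i)\<^sup>2\<close> times the value at \<open>\<phi> \<circ>\<^sub>p (\<phi> \<circ>\<^sub>p \<phi>)\<close>, and the latter determines
  the values at the parallel trees too. So the annihilator has dimension at most 1, and it is nonzero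
  iff the remaining equations in \<open>l\<close> hold; for \<open>p = 1\<close> they say \<open>l 2 = l 3 = 0\<close> and \<open>l 4 \<in> {0, 1}\<close>,
  or \<open>l 4 = 1\<close>, \<open>l 3 = (l 2)\<^sup>2\<close> and \<open>(l 2)\<^sup>3 = 1\<close>.
\<close>

subsection \<open>Trees with up to three nodes and partial compositions\<close>

abbreviation corolla :: tree where
  "corolla \<equiv> Node Leaf Leaf Leaf Leaf"

text \<open>Every internal node replaces one leaf by four. So the arity determines the number of
  nodes, and nonzero components occur only in arities congruent to 1 modulo 3.\<close>

lemma leaves_eq_nodes: "leaves t = 3 * nodes t + 1"
  by (induction t) auto

lemma nodes_graft: "1 \<le> i \<Longrightarrow> i \<le> leaves s \<Longrightarrow> nodes (graft s i t) = nodes s + nodes t"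
  using leaves_graft[of i s t] by (simp add: leaves_eq_nodes)

lemma graft_Leaf: "graft s i Leaf = s"
  by (induction s arbitrary: i) auto

lemma nodes_eq_0_iff: "nodes t = 0 \<longleftrightarrow> t = Leaf"
  by (cases t) auto

lemma nodes_eq_1_iff: "nodes t = Suc 0 \<longleftrightarrow> t = corolla"
  by (cases t) (auto simp: nodes_eq_0_iff)

lemma atLeastAtMost_1_4: "{1..4} = {1, 2, 3, 4::nat}"
  by auto

lemma atLeastAtMost_1_7: "{1..7} = {1, 2, 3, 4, 5, 6, 7::nat}"
  by auto

lemma nodes_eq_2_iff: "nodes t = 2 \<longleftrightarrow> t \<in> (\<lambda>k. graft corolla k corolla) ` {1..4}"
proof (cases t)
  case (Node a b c d)
  then have "nodes t = 2 \<longleftrightarrow> nodes a + nodes b + nodes c + nodes d = Suc 0"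
    by simp
  then show ?thesis
    using Node unfolding atLeastAtMost_1_4
    by (auto simp: add_is_1 nodes_eq_0_iff nodes_eq_1_iff)
qed (auto simp: atLeastAtMost_1_4)

text \<open>The first set consists of the chains of three nodes. In the second both lower nodes hang
  from the root; the larger index \<open>k\<close> is filled first, so that leaf \<open>i\<close>
  keeps its number.\<close>

definition cubic_trees :: "tree set" where
  "cubic_trees = (\<lambda>(i, k). graft corolla i (graft corolla k corolla)) ` ({1..4} \<times> {1..4}) \<union>
    (\<lambda>(i, k). graft (graft corolla k corolla) i corolla) ` {(i, k). 1 \<le> i \<and> i < k \<and> k \<le> 4}"

lemma pairs_less_4: "{(i, k). 1 \<le> i \<and> i < k \<and> k \<le> 4} =
  {(1, 2), (1, 3), (1, 4), (2, 3), (2, 4), (3, 4::nat)}"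
  by auto

text \<open>The ten ways to distribute two nodes over the four subtrees of the root: both in one
  subtree, or one each in two subtrees (a parallel tree).\<close>

lemma sum_eq_2_cases:
  assumes "w + x + y + z = (2::nat)"
  shows "w = 2 \<and> x = 0 \<and> y = 0 \<and> z = 0 \<or> w = 0 \<and> x = 2 \<and> y = 0 \<and> z = 0 \<or>
    w = 0 \<and> x = 0 \<and> y = 2 \<and> z = 0 \<or> w = 0 \<and> x = 0 \<and> y = 0 \<and> z = 2 \<or>
    w = 1 \<and> x = 1 \<and> y = 0 \<and> z = 0 \<or> w = 1 \<and> x = 0 \<and> y = 1 \<and> z = 0 \<or>
    w = 1 \<and> x = 0 \<and> y = 0 \<and> z = 1 \<or> w = 0 \<and> x = 1 \<and> y = 1 \<and> z = 0 \<or>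
    w = 0 \<and> x = 1 \<and> y = 0 \<and> z = 1 \<or> w = 0 \<and> x = 0 \<and> y = 1 \<and> z = 1"
  using assms by presburger

lemma nested_in_cubic_trees:
  "i \<in> {1..4} \<Longrightarrow> k \<in> {1..4} \<Longrightarrow> graft corolla i (graft corolla k corolla) \<in> cubic_trees"
  unfolding cubic_trees_def by (intro UnI1 image_eqI[of _ _ "(i, k)"]) (simp_all del: graft.simps)

lemma parallel_in_cubic_trees:
  "1 \<le> i \<Longrightarrow> i < k \<Longrightarrow> k \<le> 4 \<Longrightarrow> graft (graft corolla k corolla) i corolla \<in> cubic_trees"
  unfolding cubic_trees_def by (intro UnI2 image_eqI[of _ _ "(i, k)"]) (simp_all del: graft.simps)

lemma cubic_trees_eq: "cubic_trees = {t. nodes t = 3}"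
proof
  show "cubic_trees \<subseteq> {t. nodes t = 3}"
    by (auto simp: cubic_trees_def nodes_graft leaves_eq_nodes simp del: graft.simps)
  show "{t. nodes t = 3} \<subseteq> cubic_trees"
  proof
    fix t assume "t \<in> {t. nodes t = 3}"
    then obtain a b c d where t: "t = Node a b c d"
      and sum: "nodes a + nodes b + nodes c + nodes d = 2"
      by (cases t) auto
    have nested: "graft corolla i s \<in> cubic_trees" if "nodes s = 2" "i \<in> {1..4}" for i s
      using that nested_in_cubic_trees unfolding nodes_eq_2_iff by blast
    show "t \<in> cubic_trees"
      unfolding t using sum_eq_2_cases[OF sum]
        nested[of a 1] nested[of b 2] nested[of c 3] nested[of d 4]
        parallel_in_cubic_trees[of 1 2] parallel_in_cubic_trees[of 1 3]
        parallel_in_cubic_trees[of 1 4] parallel_in_cubic_trees[of 2 3]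
        parallel_in_cubic_trees[of 2 4] parallel_in_cubic_trees[of 3 4]
      by (elim disjE conjE) (simp_all add: nodes_eq_0_iff nodes_eq_1_iff)
  qed
qed

lemma finite_cubic_trees: "finite cubic_trees"
  unfolding cubic_trees_def pairs_less_4 by simp

lemma card_cubic_trees: "card cubic_trees = 22"
  unfolding cubic_trees_def pairs_less_4 atLeastAtMost_1_4 by (simp add: Times_insert_left)

section \<open>The monomial basis and bilinearity of partial composition\<close>

lemma subspace_component: "operad.subspace (component k)"
  using keys_add unfolding operad.subspace_def component_def
  by (fastforce simp: in_keys_iff lookup_scale)

lemma monomial_in_component: "monomial t \<in> component k \<longleftrightarrow> leaves t = k"
  by (simp add: monomial_def component_def)

lemma inj_monomial: "inj (monomial :: tree \<Rightarrow> tree \<Rightarrow>\<^sub>0 'a::field)"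
  by (rule injI) (metis monomial_def keys_single singleton_inject zero_neq_one)

lemma lookup_monomial: "Poly_Mapping.lookup (monomial s) t = (if s = t then 1 else 0)"
  by (simp add: monomial_def lookup_single when_def)

lemma sum_monomials:
  fixes f :: "tree \<Rightarrow>\<^sub>0 'a::field"
  assumes "finite A" "Poly_Mapping.keys f \<subseteq> A"
  shows "f = (\<Sum>t\<in>A. scale (Poly_Mapping.lookup f t) (monomial t))"
proof -
  have "Poly_Mapping.lookup f t =
      Poly_Mapping.lookup (\<Sum>s\<in>A. scale (Poly_Mapping.lookup f s) (monomial s)) t" for t
  proof -
    have "(\<Sum>s\<in>A. Poly_Mapping.lookup f s * (if s = t then 1 else 0)) =
        (if t \<in> A then Poly_Mapping.lookup f t else 0)"
      using assms(1) by (simp add: if_distrib cong: if_cong)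
    then show ?thesis
      using assms(2) by (auto simp: lookup_sum lookup_scale lookup_monomial in_keys_iff)
  qed
  then show ?thesis by (rule poly_mapping_eqI)
qed

lemma component_eq_span:
  "component k = operad.span (monomial ` {t. leaves t = k} :: (tree \<Rightarrow>\<^sub>0 'a::field) set)"
  (is "_ = ?S")
proof
  show "component k \<subseteq> ?S"
  proof
    fix f :: "tree \<Rightarrow>\<^sub>0 'a" assume f: "f \<in> component k"
    have "(\<Sum>t\<in>Poly_Mapping.keys f. scale (Poly_Mapping.lookup f t) (monomial t)) \<in>
        ?S"
      using f by (intro operad.span_sum operad.span_scale operad.span_base)
        (auto simp: component_def)
    then show "f \<in> ?S"
      using sum_monomials[of "Poly_Mapping.keys f" f] by simp
  qed
  show "?S \<subseteq> component k"
    by (intro operad.span_minimal subspace_component) (auto simp: monomial_in_component)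
qed

lemma independent_monomials: "operad.independent (monomial ` A :: (tree \<Rightarrow>\<^sub>0 'a::field) set)"
proof -
  have "u v = 0" if "S \<subseteq> monomial ` A" "finite S" "(\<Sum>w\<in>S. scale (u w) w) = 0" "v \<in> S"
    for S u and v :: "tree \<Rightarrow>\<^sub>0 'a"
  proof -
    from that(1,4) obtain t where t: "v = monomial t" by blast
    have "0 = Poly_Mapping.lookup (\<Sum>w\<in>S. scale (u w) w) t"
      using that(3) by simp
    also have "\<dots> = (\<Sum>w\<in>S. if w = v then u w else 0)"
      unfolding lookup_sum using that(1)
      by (intro sum.cong) (auto simp: t lookup_scale lookup_monomial dest!: subsetD split: if_splits)
    also have "\<dots> = u v"
      using that by simp
    finally show ?thesis by simp
  qed
  then show ?thesis
    unfolding operad.independent_explicit_finite_subsets by blast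
qed

text \<open>Terms outside the supports contribute zero, so the sums may run over any finite
  supersets. This lets \<open>f\<close>, \<open>h\<close> and \<open>f + h\<close> share one index
  set in the linearity proofs.\<close>

lemma partial_comp_superset:
  assumes "finite A" "Poly_Mapping.keys f \<subseteq> A" "finite B" "Poly_Mapping.keys g \<subseteq> B"
  shows "f \<circ>[i] g = (\<Sum>s\<in>A. \<Sum>t\<in>B.
    scale (Poly_Mapping.lookup f s * Poly_Mapping.lookup g t) (monomial (graft s i t)))"
proof -
  have "f \<circ>[i] g = (\<Sum>s\<in>Poly_Mapping.keys f. \<Sum>t\<in>B.
      scale (Poly_Mapping.lookup f s * Poly_Mapping.lookup g t) (monomial (graft s i t)))"
    unfolding partial_comp_def using assms
    by (intro sum.cong sum.mono_neutral_left) (auto simp: in_keys_iff)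
  also have "\<dots> = (\<Sum>s\<in>A. \<Sum>t\<in>B.
      scale (Poly_Mapping.lookup f s * Poly_Mapping.lookup g t) (monomial (graft s i t)))"
    using assms by (intro sum.mono_neutral_left) (auto simp: in_keys_iff)
  finally show ?thesis .
qed

lemma linear_partial_comp_left: "Vector_Spaces.linear scale scale (\<lambda>f. f \<circ>[i] g)"
proof (unfold Vector_Spaces.linear_iff, intro conjI allI operad.vector_space_axioms)
  fix f h :: "tree \<Rightarrow>\<^sub>0 'a" and c :: 'a
  let ?A = "Poly_Mapping.keys f \<union> Poly_Mapping.keys h"
  have "Poly_Mapping.keys (f + h) \<subseteq> ?A" by (rule keys_add)
  then show "(f + h) \<circ>[i] g = (f \<circ>[i] g) + (h \<circ>[i] g)"
    by (simp add: partial_comp_superset[of ?A _ "Poly_Mapping.keys g"] lookup_add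
        distrib_right operad.scale_left_distrib sum.distrib)
  have "Poly_Mapping.keys (scale c f) \<subseteq> Poly_Mapping.keys f"
    by (auto simp: in_keys_iff lookup_scale)
  then show "scale c f \<circ>[i] g = scale c (f \<circ>[i] g)"
    by (simp add: partial_comp_superset[of "Poly_Mapping.keys f" _ "Poly_Mapping.keys g"]
        lookup_scale operad.scale_sum_right mult.assoc)
qed

lemma linear_partial_comp_right: "Vector_Spaces.linear scale scale (\<lambda>g. f \<circ>[i] g)"
proof (unfold Vector_Spaces.linear_iff, intro conjI allI operad.vector_space_axioms)
  fix g h :: "tree \<Rightarrow>\<^sub>0 'a" and c :: 'a
  let ?B = "Poly_Mapping.keys g \<union> Poly_Mapping.keys h"
  have "Poly_Mapping.keys (g + h) \<subseteq> ?B" by (rule keys_add)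
  then show "f \<circ>[i] (g + h) = (f \<circ>[i] g) + (f \<circ>[i] h)"
    by (simp add: partial_comp_superset[of "Poly_Mapping.keys f" _ ?B] lookup_add
        distrib_left operad.scale_left_distrib sum.distrib)
  have "Poly_Mapping.keys (scale c g) \<subseteq> Poly_Mapping.keys g"
    by (auto simp: in_keys_iff lookup_scale)
  then show "f \<circ>[i] scale c g = scale c (f \<circ>[i] g)"
    by (simp add: partial_comp_superset[of "Poly_Mapping.keys f" _ "Poly_Mapping.keys g"]
        lookup_scale operad.scale_sum_right ac_simps)
qed

lemma partial_comp_monomials: "monomial s \<circ>[i] monomial t = monomial (graft s i t)"
  by (subst partial_comp_superset[of "{s}" _ "{t}"]) (auto simp: lookup_monomial monomial_def)

lemma partial_comp_in_component:
  assumes "f \<in> component k" "g \<in> component l" "1 \<le> i" "i \<le> k"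
  shows "f \<circ>[i] g \<in> component (k + l - 1)"
  unfolding partial_comp_def
proof (intro operad.subspace_sum operad.subspace_scale subspace_component)
  fix s t assume "s \<in> Poly_Mapping.keys f" "t \<in> Poly_Mapping.keys g"
  then show "monomial (graft s i t) \<in> component (k + l - 1)"
    using assms by (auto simp: component_def monomial_in_component leaves_graft monomial_def)
qed

section \<open>Separating functionals and subspaces of codimension one\<close>

lemma vector_space_mult: "vector_space ((*) :: 'a::field \<Rightarrow> 'a \<Rightarrow> 'a)"
  by unfold_locales (auto simp: algebra_simps)

text \<open>For a maximal independent subset \<open>B\<close> of \<open>S\<close>, the set
  \<open>insert v B\<close> is still independent, so a functional can be prescribed as 1 at
  \<open>v\<close> and 0 on \<open>B\<close>.\<close>

lemma separating_functional:
  fixes v :: "tree \<Rightarrow>\<^sub>0 'a::field"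
  assumes "v \<notin> operad.span S"
  obtains f where "Vector_Spaces.linear scale (*) f" "\<And>w. w \<in> operad.span S \<Longrightarrow> f w = 0" "f v = 1"
proof -
  interpret vector_space_pair scale "(*) :: 'a \<Rightarrow> 'a \<Rightarrow> 'a"
    by (intro vector_space_pair.intro operad.vector_space_axioms vector_space_mult)
  obtain B where B: "B \<subseteq> S" "operad.independent B" "S \<subseteq> operad.span B"
    by (rule operad.maximal_independent_subset)
  have "v \<notin> operad.span B"
    using assms operad.span_mono[OF B(1)] by blast
  then have "operad.independent (insert v B)"
    using B(2) by (rule operad.independent_insertI)
  then obtain f where f: "Vector_Spaces.linear scale (*) f"
    "\<forall>w\<in>insert v B. f w = (if w = v then 1 else 0)"
    using linear_independent_extend[of _ "\<lambda>w. if w = v then 1 else 0"] by metis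
  have "f w = 0" if "w \<in> operad.span S" for w
  proof -
    have "w \<in> operad.span B"
      using that operad.span_minimal[OF B(3)] by blast
    moreover have "f b = 0" if "b \<in> B" for b
      using that f(2) \<open>v \<notin> operad.span B\<close> operad.span_base by auto
    ultimately show ?thesis
      using linear_eq_0_on_span[OF f(1)] by blast
  qed
  with f show ?thesis using that by auto
qed

text \<open>A basis of \<open>C\<close> stays independent inside \<open>operad.span W\<close> after
  \<open>v\<close> is adjoined, and an independent set there has at most \<open>card W\<close>
  elements.\<close>

lemma dim_less_card:
  assumes "operad.subspace C" "C \<subseteq> operad.span W" "finite W" "v \<in> operad.span W" "v \<notin> C"
  shows "operad.dim C < card W"
proof -
  obtain B where B: "B \<subseteq> C" "operad.independent B" "C \<subseteq> operad.span B" "card B = operad.dim C"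
    by (rule operad.basis_exists)
  have "operad.span B \<subseteq> C"
    using B(1) assms(1) by (rule operad.span_minimal)
  then have "v \<notin> operad.span B" using assms(5) by blast
  then have "operad.independent (insert v B)" "v \<notin> B"
    using B(2) operad.span_base operad.independent_insertI by blast+
  moreover have "insert v B \<subseteq> operad.span W"
    using B(1) assms by auto
  ultimately show ?thesis
    using operad.independent_span_bound[OF assms(3)] B(4) by fastforce
qed

text \<open>A basis of \<open>C\<close> together with the single vector \<open>v\<close> spans
  \<open>W\<close>, so the independent set \<open>W\<close> has at most one element more than that
  basis.\<close>

lemma card_le_Suc_dim:
  assumes "operad.independent W" "finite W" "C \<subseteq> operad.span W" "W \<subseteq> operad.span (insert v C)"
  shows "card W \<le> Suc (operad.dim C)"
proof -
  obtain B where B: "B \<subseteq> C" "operad.independent B" "C \<subseteq> operad.span B" "card B = operad.dim C"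
    by (rule operad.basis_exists)
  have "finite B"
    using operad.independent_span_bound[OF assms(2) B(2)] B(1) assms(3) by blast
  have "insert v C \<subseteq> operad.span (insert v B)"
    using B(3) operad.span_mono[of B "insert v B"] operad.span_base by blast
  then have "W \<subseteq> operad.span (insert v B)"
    using assms(4) operad.span_minimal[OF _ operad.subspace_span] by blast
  then have "card W \<le> card (insert v B)"
    using operad.independent_span_bound[OF _ assms(1)] \<open>finite B\<close> by simp
  also have "\<dots> \<le> Suc (card B)"
    by (rule card_insert_le_m1) simp_all
  finally show ?thesis using B(4) by simp
qed

subsection \<open>The components of arity 7 and 10 of the ideal\<close>

lemma phi_eq: "phi = monomial corolla"
  by (simp add: phi_def)

lemma phi_comp_phi: "phi \<circ>[k] phi = monomial (graft corolla k corolla)"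
  by (simp add: phi_eq partial_comp_monomials)

lemma component_trivial:
  assumes "k mod 3 \<noteq> 1" shows "component k = {0}"
proof -
  have "{t. leaves t = k} = {}" using assms by (auto simp: leaves_eq_nodes)
  then show ?thesis unfolding component_eq_span by simp
qed

lemma component_1: "component 1 = range (\<lambda>c. scale c (monomial Leaf))"
proof -
  have "{t. leaves t = 1} = {Leaf}" by (auto simp: leaves_eq_nodes nodes_eq_0_iff)
  then show ?thesis unfolding component_eq_span by (simp add: operad.span_singleton)
qed

lemma component_4: "component 4 = range (\<lambda>c. scale c phi)"
proof -
  have "{t. leaves t = 4} = {corolla}" by (auto simp: leaves_eq_nodes nodes_eq_1_iff)
  then show ?thesis unfolding component_eq_span phi_eq by (simp add: operad.span_singleton)
qed

lemma leaves_7: "{t. leaves t = 7} = (\<lambda>k. graft corolla k corolla) ` {1..4}"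
  using nodes_eq_2_iff by (auto simp: leaves_eq_nodes simp del: graft.simps)

lemma leaves_10: "{t. leaves t = 10} = cubic_trees"
  by (auto simp: leaves_eq_nodes cubic_trees_eq)

lemma inj_on_graft_corolla: "inj_on (\<lambda>k. graft corolla k corolla) {1..4}"
  unfolding atLeastAtMost_1_4 by simp

lemma component_7_eq_sum:
  assumes "f \<in> component 7"
  shows "f = (\<Sum>k\<in>{1..4}. scale (Poly_Mapping.lookup f (graft corolla k corolla)) (phi \<circ>[k] phi))"
proof -
  have "Poly_Mapping.keys f \<subseteq> (\<lambda>k. graft corolla k corolla) ` {1..4}"
    using assms unfolding leaves_7[symmetric] component_def by blast
  from sum_monomials[OF finite_imageI[OF finite_atLeastAtMost] this,
      unfolded sum.reindex[OF inj_on_graft_corolla] o_def]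
  show ?thesis unfolding phi_comp_phi .
qed

lemma partial_comp_0_left: "0 \<circ>[i] g = 0" and partial_comp_0_right: "f \<circ>[i] 0 = 0"
  by (simp_all add: partial_comp_def)

lemma partial_comp_scale_left: "scale c f \<circ>[i] g = scale c (f \<circ>[i] g)"
  using linear_partial_comp_left[of i g] unfolding Vector_Spaces.linear_iff by blast

lemma partial_comp_scale_right: "f \<circ>[i] scale c g = scale c (f \<circ>[i] g)"
  using linear_partial_comp_right[of f i] unfolding Vector_Spaces.linear_iff by blast

lemma partial_comp_Leaf_right: "f \<circ>[i] monomial Leaf = f"
proof -
  have "f \<circ>[i] monomial Leaf =
      (\<Sum>t\<in>Poly_Mapping.keys f. scale (Poly_Mapping.lookup f t) (monomial t))"
    by (subst partial_comp_superset[of "Poly_Mapping.keys f" _ "{Leaf}"])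
      (auto simp: monomial_def graft_Leaf)
  then show ?thesis using sum_monomials[of "Poly_Mapping.keys f" f] by simp
qed

lemma partial_comp_Leaf_left: "monomial Leaf \<circ>[1] g = g"
proof -
  have "monomial Leaf \<circ>[1] g =
      (\<Sum>t\<in>Poly_Mapping.keys g. scale (Poly_Mapping.lookup g t) (monomial t))"
    by (subst partial_comp_superset[of "{Leaf}" _ "Poly_Mapping.keys g"])
      (auto simp: monomial_def)
  then show ?thesis using sum_monomials[of "Poly_Mapping.keys g" g] by simp
qed

text \<open>Here \<open>\<rho>\<close> ranges over all of \<open>R\<close> instead of a basis;
  composition is linear in \<open>\<rho>\<close>, so the span is the same for a subspace
  \<open>R\<close>.\<close>

definition cubic_consequences :: "(tree \<Rightarrow>\<^sub>0 'a::field) set \<Rightarrow> (tree \<Rightarrow>\<^sub>0 'a) set" where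
  "cubic_consequences R =
    (\<lambda>(\<rho>, j). \<rho> \<circ>[j] phi) ` (R \<times> {1..7}) \<union> (\<lambda>(\<rho>, i). phi \<circ>[i] \<rho>) ` (R \<times> {1..4})"

lemma cubic_consequencesI:
  "\<rho> \<in> R \<Longrightarrow> 1 \<le> j \<Longrightarrow> j \<le> 7 \<Longrightarrow> \<rho> \<circ>[j] phi \<in> cubic_consequences R"
  "\<rho> \<in> R \<Longrightarrow> 1 \<le> i \<Longrightarrow> i \<le> 4 \<Longrightarrow> phi \<circ>[i] \<rho> \<in> cubic_consequences R"
  unfolding cubic_consequences_def by force+

lemma phi_in_component: "phi \<in> component 4"
  by (simp add: phi_eq monomial_in_component)

lemma cubic_consequences_in_component:
  assumes "R \<subseteq> component 7" shows "cubic_consequences R \<subseteq> component 10"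
proof -
  have "\<rho> \<circ>[j] phi \<in> component 10" if "\<rho> \<in> R" "1 \<le> j" "j \<le> 7" for \<rho> j
    using partial_comp_in_component[of \<rho> 7 phi 4 j] that assms phi_in_component by auto
  moreover have "phi \<circ>[j] \<rho> \<in> component 10" if "\<rho> \<in> R" "1 \<le> j" "j \<le> 4" for \<rho> j
    using partial_comp_in_component[of phi 4 \<rho> 7 j] that assms phi_in_component by auto
  ultimately show ?thesis by (auto simp: cubic_consequences_def)
qed

text \<open>
  The ideal generated by quadratic relations is contained in the one that agrees with it up to
  arity 10 and contains everything in higher arities.
\<close>
definition truncated_ideal :: "(tree \<Rightarrow>\<^sub>0 'a::field) set \<Rightarrow> nat \<Rightarrow> (tree \<Rightarrow>\<^sub>0 'a) set" where
  "truncated_ideal R k =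
    (if k = 7 then R else if k = 10 then operad.span (cubic_consequences R)
     else if k < 10 then {0} else component k)"

text \<open>Composing with arity 1 only rescales, composing a relation with a multiple of
  \<open>phi\<close> gives a multiple of a cubic consequence, and every other composition of nonzero
  elements has arity above 10, where the whole component is allowed.\<close>

lemma operad_ideal_truncated:
  assumes R: "operad.subspace R" "R \<subseteq> component 7"
  shows "operad_ideal (truncated_ideal R)"
proof -
  let ?J = "truncated_ideal R"
  have sub: "operad.subspace (?J k)" for k
    using R by (simp add: truncated_ideal_def subspace_component operad.subspace_single_0)
  have in_comp: "?J k \<subseteq> component k" for k
    using R operad.span_minimal[OF cubic_consequences_in_component subspace_component]
      operad.subspace_0[OF subspace_component, of k]
    by (auto simp: truncated_ideal_def)
  have J0: "0 \<in> ?J k" for k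
    using sub by (rule operad.subspace_0)
  have large: "?J k = component k" if "10 < k" for k
    using that by (simp add: truncated_ideal_def)
  have left: "f \<circ>[i] g \<in> ?J (k + l - 1)" if f: "f \<in> ?J k" and g: "g \<in> component l"
    and i: "1 \<le> i" "i \<le> k" for k l i and f g :: "tree \<Rightarrow>\<^sub>0 'a"
  proof (cases "f = 0 \<or> g = 0")
    case True
    then show ?thesis using J0 by (auto simp: partial_comp_0_left partial_comp_0_right)
  next
    case False
    \<comment> \<open>Nonzero elements of the free operad live in arities 1, 4, 7, ..., and those of
      the truncated ideal in arity 7 or at least 10.\<close>
    then have "l mod 3 = 1" "k = 7 \<or> 10 \<le> k"
      using f g component_trivial[of l] by (auto simp: truncated_ideal_def split: if_splits)
    then have "l = 1 \<or> k = 7 \<and> l = 4 \<or> 10 < k + l - 1"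
      by presburger
    then consider "l = 1" | "k = 7" "l = 4" | "10 < k + l - 1"
      by blast
    then show ?thesis
    proof cases
      case 1
      then obtain c where "g = scale c (monomial Leaf)" using g component_1 by auto
      then show ?thesis
        using 1 f sub operad.subspace_scale
        by (auto simp: partial_comp_scale_right partial_comp_Leaf_right)
    next
      case 2
      then obtain c where "g = scale c phi" using g component_4 by auto
      then show ?thesis
        using 2 f i by (auto simp: truncated_ideal_def partial_comp_scale_right
            intro!: operad.span_scale[OF operad.span_base[OF cubic_consequencesI(1)]])
    next
      case 3
      then show ?thesis using partial_comp_in_component[of f k g l i] f g i in_comp large by auto
    qed
  qed
  have right: "f \<circ>[i] g \<in> ?J (k + l - 1)" if f: "f \<in> component k" and g: "g \<in> ?J l"
    and i: "1 \<le> i" "i \<le> k" for k l i and f g :: "tree \<Rightarrow>\<^sub>0 'a"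
  proof (cases "f = 0 \<or> g = 0")
    case True
    then show ?thesis using J0 by (auto simp: partial_comp_0_left partial_comp_0_right)
  next
    case False
    then have "k mod 3 = 1" "l = 7 \<or> 10 \<le> l"
      using f g component_trivial[of k] by (auto simp: truncated_ideal_def split: if_splits)
    then have "k = 1 \<or> l = 7 \<and> k = 4 \<or> 10 < k + l - 1"
      by presburger
    then consider "k = 1" | "l = 7" "k = 4" | "10 < k + l - 1"
      by blast
    then show ?thesis
    proof cases
      case 1
      then obtain c where "f = scale c (monomial Leaf)" using f component_1 by auto
      moreover have "i = 1" using 1 i by simp
      ultimately show ?thesis
        using 1 g sub operad.subspace_scale partial_comp_Leaf_left[of g]
        by (auto simp: partial_comp_scale_left)
    next
      case 2
      then obtain c where "f = scale c phi" using f component_4 by auto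
      then show ?thesis
        using 2 g i by (auto simp: truncated_ideal_def partial_comp_scale_left
            intro!: operad.span_scale[OF operad.span_base[OF cubic_consequencesI(2)]])
    next
      case 3
      then show ?thesis using partial_comp_in_component[of f k g l i] f g i in_comp large by auto
    qed
  qed
  show ?thesis
    unfolding operad_ideal_def using sub in_comp left right by blast
qed

lemma generated_ideal_subset_truncated:
  assumes "operad.subspace R" "R \<subseteq> component 7"
  shows "generated_ideal R k \<subseteq> truncated_ideal R k"
proof -
  have "R \<inter> component m \<subseteq> truncated_ideal R m" for m
  proof (cases "m = 7")
    case False
    have "f = 0" if "f \<in> component 7" "f \<in> component m" for f :: "tree \<Rightarrow>\<^sub>0 'a"
    proof -
      have "Poly_Mapping.keys f = {}" using that False by (auto simp: component_def)
      then show ?thesis by simp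
    qed
    moreover have "0 \<in> truncated_ideal R m"
      using operad_ideal_truncated[OF assms] operad.subspace_0 unfolding operad_ideal_def by blast
    ultimately show ?thesis using assms(2) by blast
  qed (simp add: truncated_ideal_def)
  then show ?thesis
    using operad_ideal_truncated[OF assms] unfolding generated_ideal_def by blast
qed

lemma generated_ideal_7:
  assumes "operad.subspace R" "R \<subseteq> component 7"
  shows "generated_ideal R 7 = R"
proof
  show "generated_ideal R 7 \<subseteq> R"
    using generated_ideal_subset_truncated[OF assms, of 7] by (simp add: truncated_ideal_def)
  show "R \<subseteq> generated_ideal R 7"
    using assms(2) unfolding generated_ideal_def by blast
qed

text \<open>The truncated ideal bounds this component from above. From below, every ideal containing
  \<open>R\<close> is closed under composing relations with \<open>phi\<close> on either
  side.\<close>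

lemma generated_ideal_10:
  assumes "operad.subspace R" "R \<subseteq> component 7"
  shows "generated_ideal R 10 = operad.span (cubic_consequences R)"
proof
  show "generated_ideal R 10 \<subseteq> operad.span (cubic_consequences R)"
    using generated_ideal_subset_truncated[OF assms, of 10] by (simp add: truncated_ideal_def)
  have "operad.span (cubic_consequences R) \<subseteq> J 10"
    if J: "operad_ideal J" "\<forall>m. R \<inter> component m \<subseteq> J m" for J
  proof (rule operad.span_minimal)
    show "operad.subspace (J 10)" using J(1) by (simp add: operad_ideal_def)
    have RJ: "R \<subseteq> J 7" using J(2) assms(2) by blast
    have "\<rho> \<circ>[j] phi \<in> J (7 + 4 - 1)" if "\<rho> \<in> R" "1 \<le> j" "j \<le> 7" for \<rho> j
      using J(1) RJ that phi_in_component unfolding operad_ideal_def by blast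
    moreover have "phi \<circ>[j] \<rho> \<in> J (4 + 7 - 1)" if "\<rho> \<in> R" "1 \<le> j" "j \<le> 4" for \<rho> j
      using J(1) RJ that phi_in_component unfolding operad_ideal_def by blast
    ultimately show "cubic_consequences R \<subseteq> J 10"
      by (auto simp: cubic_consequences_def)
  qed
  then show "operad.span (cubic_consequences R) \<subseteq> generated_ideal R 10"
    unfolding generated_ideal_def by blast
qed

subsection \<open>Spaces of quadratic relations\<close>

text \<open>A three-dimensional space of relations is stored by one covector instead of a basis,
  which turns the classification into solving equations in \<open>l\<close>.\<close>

definition relations :: "(nat \<Rightarrow> 'a::field) \<Rightarrow> (tree \<Rightarrow>\<^sub>0 'a) set" where
  "relations l = {f \<in> component 7.
    (\<Sum>k\<in>{1..4}. l k * Poly_Mapping.lookup f (graft corolla k corolla)) = 0}"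

lemma phi_comp_phi_in_component: "1 \<le> k \<Longrightarrow> k \<le> 4 \<Longrightarrow> phi \<circ>[k] phi \<in> component 7"
  unfolding phi_comp_phi monomial_in_component by (simp add: leaves_graft del: graft.simps)

lemma lookup_phi_comp_phi:
  assumes "j \<in> {1..4}" "k \<in> {1..4}"
  shows "Poly_Mapping.lookup (phi \<circ>[j] phi) (graft corolla k corolla) = (if j = k then 1 else 0)"
  using inj_onD[OF inj_on_graft_corolla _ assms]
  by (auto simp: phi_comp_phi lookup_monomial simp del: graft.simps)

lemma subspace_relations: "operad.subspace (relations l)"
proof -
  let ?F = "\<lambda>f. \<Sum>k\<in>{1..4}. l k * Poly_Mapping.lookup f (graft corolla k corolla)"
  have "?F (f + g) = ?F f + ?F g" for f g
    by (simp only: lookup_add distrib_left sum.distrib)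
  moreover have "?F (scale c f) = c * ?F f" for c f
    by (simp only: lookup_scale sum_distrib_left mult.left_commute)
  ultimately show ?thesis
    using subspace_component[of 7, where ?'a = 'a]
    unfolding operad.subspace_def relations_def by (simp del: graft.simps)
qed

lemma relation_in_relations:
  assumes "l p = 1" "p \<in> {1..4}" "k \<in> {1..4}"
  shows "phi \<circ>[k] phi - scale (l k) (phi \<circ>[p] phi) \<in> relations l"
proof -
  have "(\<Sum>j\<in>{1..4}. l j * ((if k = j then 1 else 0) - l k * (if p = j then 1 else 0))) =
      l k - l k * l p"
    (is "sum ?g _ = _")
  proof -
    have "sum ?g {1..4} =
        (\<Sum>j\<in>{1..4}. (if k = j then l k else 0) - (if p = j then l k * l p else 0))"
      by (intro sum.cong) (auto simp: right_diff_distrib)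
    then show ?thesis using assms(2,3) by (simp add: sum_subtractf)
  qed
  moreover have "(\<Sum>j\<in>{1..4}. l j * Poly_Mapping.lookup
        (phi \<circ>[k] phi - scale (l k) (phi \<circ>[p] phi)) (graft corolla j corolla)) =
      (\<Sum>j\<in>{1..4}. l j * ((if k = j then 1 else 0) - l k * (if p = j then 1 else 0)))"
    using assms(2,3)
    by (intro sum.cong) (simp_all only: lookup_minus lookup_scale lookup_phi_comp_phi)
  moreover have "phi \<circ>[k] phi - scale (l k) (phi \<circ>[p] phi) \<in> component 7"
    using assms(2,3) phi_comp_phi_in_component
    by (auto intro!: operad.subspace_diff operad.subspace_scale subspace_component)
  ultimately show ?thesis using assms(1) by (simp add: relations_def del: graft.simps)
qed

text \<open>Since \<open>l p = 1\<close>, the defining equation can be solved for the coefficient of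
  \<open>phi \<circ>[p] phi\<close>, and the other three coefficients are free.\<close>

lemma relations_eq_span:
  assumes "l p = 1" "p \<in> {1..4}"
  shows "relations l =
    operad.span ((\<lambda>k. phi \<circ>[k] phi - scale (l k) (phi \<circ>[p] phi)) ` ({1..4} - {p}))"
    (is "_ = operad.span ?T")
proof
  show "operad.span ?T \<subseteq> relations l"
    using relation_in_relations[of l p, OF assms] by (intro operad.span_minimal subspace_relations) blast
  show "relations l \<subseteq> operad.span ?T"
  proof
    fix f assume "f \<in> relations l"
    define c where "c k = Poly_Mapping.lookup f (graft corolla k corolla)" for k
    have f: "f = (\<Sum>k\<in>{1..4}. scale (c k) (phi \<circ>[k] phi))"
      and c: "(\<Sum>k\<in>{1..4}. l k * c k) = 0"
      using \<open>f \<in> relations l\<close> component_7_eq_sum unfolding relations_def c_def by auto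
    \<comment> \<open>The summand for \<open>k = p\<close> is zero because \<open>l p = 1\<close>.
      The full sum differs from \<open>f\<close> only by the value of the defining functional at
      \<open>f\<close> times \<open>phi \<circ>[p] phi\<close>.\<close>
    have "(\<Sum>k\<in>{1..4} - {p}. scale (c k) (phi \<circ>[k] phi - scale (l k) (phi \<circ>[p] phi))) =
        (\<Sum>k\<in>{1..4}. scale (c k) (phi \<circ>[k] phi - scale (l k) (phi \<circ>[p] phi)))"
      using assms by (intro sum.mono_neutral_left) auto
    also have "\<dots> = f - scale (\<Sum>k\<in>{1..4}. l k * c k) (phi \<circ>[p] phi)"
      unfolding f operad.scale_right_diff_distrib sum_subtractf operad.scale_sum_left
      by (simp add: mult.commute)
    finally have "f = (\<Sum>k\<in>{1..4} - {p}. scale (c k) (phi \<circ>[k] phi - scale (l k) (phi \<circ>[p] phi)))"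
      using c by simp
    also have "\<dots> \<in> operad.span ?T"
      by (intro operad.span_sum operad.span_scale operad.span_base) auto
    finally show "f \<in> operad.span ?T" .
  qed
qed

text \<open>A hyperplane is the kernel of a functional; dividing the values of that functional by
  the first nonzero one gives \<open>l\<close>.\<close>

lemma subspace_eq_relations:
  fixes R :: "(tree \<Rightarrow>\<^sub>0 'a::field) set"
  assumes R: "operad.subspace R" "R \<subseteq> component 7" "operad.dim R = 3"
  obtains l p where "p \<in> {1..4}" "l p = 1" "\<forall>k. 1 \<le> k \<and> k < p \<longrightarrow> l k = 0" "R = relations l"
proof -
  let ?W = "monomial ` {t. leaves t = 7} :: (tree \<Rightarrow>\<^sub>0 'a) set"
  have W: "card ?W = 4" "finite ?W"
    by (simp_all only: card_image[OF inj_on_subset[OF inj_monomial]] leaves_7 subset_UNIV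
        card_image[OF inj_on_graft_corolla] card_atLeastAtMost finite_imageI finite_atLeastAtMost)
  have span_W: "operad.span ?W = component 7"
    by (rule component_eq_span[symmetric])
  have "R \<noteq> component 7"
    using operad.dim_span_eq_card_independent[OF independent_monomials, of "{t. leaves t = 7}",
        where ?'a = 'a] W(1) R(3) unfolding span_W by auto
  then obtain v where v: "v \<in> component 7" "v \<notin> R" using R(2) by blast
  then have "v \<notin> operad.span R" using R(1) operad.span_eq_iff by metis
  from separating_functional[OF this] obtain f where f: "Vector_Spaces.linear scale (*) f"
    "\<And>w. w \<in> R \<Longrightarrow> f w = 0" "f v = 1"
    using operad.span_base by metis
  interpret f: Vector_Spaces.linear scale "(*)" f by (rule f(1))
  define m where "m k = f (phi \<circ>[k] phi)" for k
  have f_eq: "f u = (\<Sum>k\<in>{1..4}. m k * Poly_Mapping.lookup u (graft corolla k corolla))"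
    if "u \<in> component 7" for u
  proof -
    have "f u = (\<Sum>k\<in>{1..4}. f (scale (Poly_Mapping.lookup u (graft corolla k corolla)) (phi \<circ>[k] phi)))"
      using component_7_eq_sum[OF that] f.sum by metis
    then show ?thesis by (simp add: f.scale m_def mult.commute del: graft.simps)
  qed
  \<comment> \<open>Otherwise a basis of \<open>R\<close> with \<open>u\<close> and \<open>v\<close>
    adjoined would be five independent vectors in a four-dimensional component: \<open>f\<close>
    vanishes on the first four but not at \<open>v\<close>.\<close>
  have ker: "u \<in> R" if u: "u \<in> component 7" "f u = 0" for u
  proof (rule ccontr)
    assume "u \<notin> R"
    obtain B where B: "B \<subseteq> R" "operad.independent B" "R \<subseteq> operad.span B" "card B = operad.dim R"
      by (rule operad.basis_exists)
    have span_B: "operad.span B = R"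
      using B R(1) by (intro operad.span_subspace)
    have "finite B" using B(4) R(3) by (intro card_ge_0_finite) simp
    have uB: "operad.independent (insert u B)" "u \<notin> B"
      using operad.independent_insertI[OF _ B(2)] \<open>u \<notin> R\<close> span_B B(1) by auto
    have "f w = 0" if "w \<in> operad.span (insert u B)" for w
      using that by (rule f.eq_0_on_span[rotated]) (use B(1) f(2) u(2) in auto)
    then have "v \<notin> operad.span (insert u B)" using f(3) by fastforce
    then have vuB: "operad.independent (insert v (insert u B))" "v \<notin> insert u B"
      using operad.independent_insertI[OF _ uB(1)] operad.span_base[of v "insert u B"] by blast+
    moreover have "insert v (insert u B) \<subseteq> operad.span ?W"
      unfolding span_W using v u B(1) R(2) by auto
    ultimately have "card (insert v (insert u B)) \<le> 4"
      using operad.independent_span_bound[OF W(2)] W(1) by metis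
    then show False
      using uB(2) vuB(2) \<open>finite B\<close> B(4) R(3) by simp
  qed
  have "\<exists>k. k \<in> {1..4} \<and> m k \<noteq> 0"
  proof (rule ccontr)
    assume "\<not> ?thesis"
    then have "f v = 0" unfolding f_eq[OF v(1)] by (intro sum.neutral) auto
    then show False using f(3) by simp
  qed
  then obtain p where p: "p \<in> {1..4} \<and> m p \<noteq> 0" "\<forall>k<p. \<not> (k \<in> {1..4} \<and> m k \<noteq> 0)"
    unfolding exists_least_iff[of "\<lambda>k. k \<in> {1..4} \<and> m k \<noteq> 0"] by blast
  define l where "l k = m k / m p" for k
  have "(\<Sum>k\<in>{1..4}. l k * Poly_Mapping.lookup u (graft corolla k corolla)) = f u / m p"
    if "u \<in> component 7" for u
    by (simp only: f_eq[OF that] l_def sum_divide_distrib times_divide_eq_left)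
  then have "u \<in> relations l \<longleftrightarrow> u \<in> component 7 \<and> f u = 0" for u
    using p(1) by (auto simp only: relations_def mem_Collect_eq divide_eq_0_iff)
  then have "R = relations l"
    using ker f(2) R(2) by blast
  moreover have "l p = 1" "\<forall>k. 1 \<le> k \<and> k < p \<longrightarrow> l k = 0"
    using p by (auto simp: l_def)
  ultimately show ?thesis using that p(1) by blast
qed

text \<open>By linearity it suffices to test the generators
  \<open>phi \<circ>[k] phi - scale (l k) (phi \<circ>[p] phi)\<close> of
  \<open>relations l\<close>, for which vanishing is an equation between two tree values.\<close>

lemma vanishes_on_consequences_iff:
  fixes f :: "(tree \<Rightarrow>\<^sub>0 'a::field) \<Rightarrow> 'a"
  assumes "Vector_Spaces.linear scale (*) f" "l p = 1" "p \<in> {1..4}"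
  shows "(\<forall>v\<in>cubic_consequences (relations l). f v = 0) \<longleftrightarrow>
    (\<forall>k\<in>{1..4}. (\<forall>j\<in>{1..7}. f (monomial (graft (graft corolla k corolla) j corolla)) =
         l k * f (monomial (graft (graft corolla p corolla) j corolla))) \<and>
       (\<forall>i\<in>{1..4}. f (monomial (graft corolla i (graft corolla k corolla))) =
         l k * f (monomial (graft corolla i (graft corolla p corolla)))))"
    (is "?L \<longleftrightarrow> ?R")
proof -
  interpret f: Vector_Spaces.linear scale "(*)" f by (rule assms(1))
  let ?T = "(\<lambda>k. phi \<circ>[k] phi - scale (l k) (phi \<circ>[p] phi)) ` ({1..4} - {p})"
  interpret left: Vector_Spaces.linear scale scale "\<lambda>g :: tree \<Rightarrow>\<^sub>0 'a. g \<circ>[j] phi" for j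
    by (rule linear_partial_comp_left)
  interpret right: Vector_Spaces.linear scale scale "\<lambda>g :: tree \<Rightarrow>\<^sub>0 'a. phi \<circ>[j] g" for j
    by (rule linear_partial_comp_right)
  have left: "f ((phi \<circ>[k] phi - scale (l k) (phi \<circ>[p] phi)) \<circ>[j] phi) =
      f (monomial (graft (graft corolla k corolla) j corolla)) -
      l k * f (monomial (graft (graft corolla p corolla) j corolla))" for k j
    by (simp only: left.diff left.scale f.diff f.scale) (simp only: phi_eq partial_comp_monomials)
  have right: "f (phi \<circ>[i] (phi \<circ>[k] phi - scale (l k) (phi \<circ>[p] phi))) =
      f (monomial (graft corolla i (graft corolla k corolla))) -
      l k * f (monomial (graft corolla i (graft corolla p corolla)))" for k i
    by (simp only: right.diff right.scale f.diff f.scale) (simp only: phi_eq partial_comp_monomials)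
  show ?thesis
  proof
    assume L: ?L
    have L1: "f (\<rho> \<circ>[j] phi) = 0" if "\<rho> \<in> relations l" "j \<in> {1..7}" for \<rho> j
      using L that by (simp add: cubic_consequencesI)
    have L2: "f (phi \<circ>[i] \<rho>) = 0" if "\<rho> \<in> relations l" "i \<in> {1..4}" for \<rho> i
      using L that by (simp add: cubic_consequencesI)
    note rel = relation_in_relations[of l p, OF assms(2,3)]
    show ?R
    proof (intro ballI conjI)
      fix k j :: nat assume "k \<in> {1..4}" "j \<in> {1..7}"
      from L1[OF rel[OF this(1)] this(2)]
      show "f (monomial (graft (graft corolla k corolla) j corolla)) =
          l k * f (monomial (graft (graft corolla p corolla) j corolla))"
        by (simp only: left right_minus_eq)
    next
      fix k i :: nat assume "k \<in> {1..4}" "i \<in> {1..4}"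
      from L2[OF rel[OF this(1)] this(2)]
      show "f (monomial (graft corolla i (graft corolla k corolla))) =
          l k * f (monomial (graft corolla i (graft corolla p corolla)))"
        by (simp only: right right_minus_eq)
    qed
  next
    assume R: ?R
    have sub: "operad.subspace {\<rho>. f (\<rho> \<circ>[j] phi) = 0}"
      "operad.subspace {\<rho>. f (phi \<circ>[j] \<rho>) = 0}" for j
      by (simp_all add: operad.subspace_def left.add left.scale right.add right.scale
          f.add f.scale f.zero partial_comp_0_left partial_comp_0_right)
    note span = relations_eq_span[of l p, OF assms(2,3)]
    have "relations l \<subseteq> {\<rho>. f (\<rho> \<circ>[j] phi) = 0}" if "j \<in> {1..7}" for j
      unfolding span
    proof (intro operad.span_minimal sub image_subsetI CollectI)
      fix k assume "k \<in> {1..4} - {p}"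
      then show "f ((phi \<circ>[k] phi - scale (l k) (phi \<circ>[p] phi)) \<circ>[j] phi) = 0"
        unfolding left right_minus_eq using R that by blast
    qed
    moreover have "relations l \<subseteq> {\<rho>. f (phi \<circ>[i] \<rho>) = 0}" if "i \<in> {1..4}" for i
      unfolding span
    proof (intro operad.span_minimal sub image_subsetI CollectI)
      fix k assume "k \<in> {1..4} - {p}"
      then show "f (phi \<circ>[i] (phi \<circ>[k] phi - scale (l k) (phi \<circ>[p] phi))) = 0"
        unfolding right right_minus_eq using R that by blast
    qed
    ultimately show ?L
      unfolding cubic_consequences_def by (auto simp only: Un_iff image_iff split: prod.splits)
  qed
qed

subsection \<open>Functionals annihilating the cubic consequences\<close>

text \<open>
  The coefficients, up to scaling, of the linear functional on cubic trees that vanishes on the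
  consequences of the relations with coefficients \<open>l\<close>, whenever there is such a functional.
\<close>
fun weight :: "(nat \<Rightarrow> 'a::field) \<Rightarrow> tree \<Rightarrow> 'a" where
  "weight l Leaf = 1"
| "weight l (Node a b c d) =
    (l 1 ^ nodes a * weight l a) * (l 2 ^ nodes b * weight l b) *
    (l 3 ^ nodes c * weight l c) * (l 4 ^ nodes d * weight l d)"

text \<open>The covectors follow the order of \<open>minimal_triples\<close>. When
  \<open>l 4 = 1\<close>, a relation
  \<open>(phi \<circ>[j] phi) + scale c (phi \<circ>[4] phi)\<close> forces
  \<open>l j = - c\<close>, hence the signs in the last family.\<close>

definition minimal_coefficients :: "(nat \<Rightarrow> 'a::field) \<Rightarrow> bool" where
  "minimal_coefficients l \<longleftrightarrow> (l 1, l 2, l 3, l 4) \<in>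
    {(0, 0, 0, 1), (1, 0, 0, 1), (1, 1, 1, 1), (0, 0, 1, 0), (0, 1, 0, 0), (1, 0, 0, 0)} \<union>
    {(1, - \<alpha>, - inverse \<alpha>, 1) | \<alpha>. primitive_root_of_unity 6 \<alpha>}"

text \<open>The criterion of \<open>vanishes_on_consequences_iff\<close>, stated for plain functions
  on trees so that identities between grafted trees apply directly.\<close>

definition annihilates :: "(nat \<Rightarrow> 'a::field) \<Rightarrow> nat \<Rightarrow> (tree \<Rightarrow> 'a) \<Rightarrow> bool" where
  "annihilates l p g \<longleftrightarrow>
    (\<forall>k\<in>{1..4}. (\<forall>j\<in>{1..7}. g (graft (graft corolla k corolla) j corolla) =
         l k * g (graft (graft corolla p corolla) j corolla)) \<and>
       (\<forall>i\<in>{1..4}. g (graft corolla i (graft corolla k corolla)) =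
         l k * g (graft corolla i (graft corolla p corolla))))"

lemma primitive_6th_rootD:
  fixes \<alpha> :: "'a::field_char_0"
  assumes "primitive_root_of_unity 6 \<alpha>"
  shows "\<alpha> * \<alpha> = \<alpha> - 1" "inverse \<alpha> = 1 - \<alpha>"
proof -
  have *: "\<alpha>\<^sup>2 - \<alpha> + 1 = 0" using assms by (simp add: primitive_6th_root_iff)
  then show "\<alpha> * \<alpha> = \<alpha> - 1" by algebra
  from * have "\<alpha> * (1 - \<alpha>) = 1" by algebra
  then show "inverse \<alpha> = 1 - \<alpha>" by (rule inverse_unique)
qed

text \<open>Sequential associativity: leaf \<open>i\<close> of a node hanging at leaf
  \<open>k\<close> has \<open>k - 1\<close> leaves outside that node to its left.\<close>

lemma graft_nested:
  "i \<in> {1..4} \<Longrightarrow> k \<in> {1..4} \<Longrightarrow>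
    graft (graft corolla k corolla) (k + i - 1) corolla = graft corolla k (graft corolla i corolla)"
  unfolding atLeastAtMost_1_4 by (elim insertE emptyE) simp_all

text \<open>Parallel associativity: filling leaf \<open>i\<close> with a corolla adds three leaves,
  which shifts the later leaf \<open>k\<close> to \<open>k + 3\<close>.\<close>

lemma graft_parallel:
  assumes "1 \<le> i" "i < k" "k \<le> 4"
  shows "graft (graft corolla i corolla) (k + 3) corolla = graft (graft corolla k corolla) i corolla"
proof -
  have "(i, k) \<in> {(i, k). 1 \<le> i \<and> i < k \<and> k \<le> 4}"
    using assms by simp
  then show ?thesis unfolding pairs_less_4 by (elim insertE emptyE) simp_all
qed

context
  fixes l :: "nat \<Rightarrow> 'a::field_char_0" and p g
  assumes ann: "annihilates l p g" and lp: "l p = 1" and p: "1 \<le> p" "p \<le> 4"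
    and zero: "\<And>k. 1 \<le> k \<Longrightarrow> k < p \<Longrightarrow> l k = 0"
begin

lemma annihilates_left:
  "1 \<le> k \<Longrightarrow> k \<le> 4 \<Longrightarrow> 1 \<le> j \<Longrightarrow> j \<le> 7 \<Longrightarrow>
    g (graft (graft corolla k corolla) j corolla) =
      l k * g (graft (graft corolla p corolla) j corolla)"
  using ann unfolding annihilates_def by (simp del: graft.simps)

lemma annihilates_right:
  "1 \<le> k \<Longrightarrow> k \<le> 4 \<Longrightarrow> 1 \<le> i \<Longrightarrow> i \<le> 4 \<Longrightarrow>
    g (graft corolla i (graft corolla k corolla)) =
      l k * g (graft corolla i (graft corolla p corolla))"
  using ann unfolding annihilates_def by (simp del: graft.simps)

text \<open>Relations composed with \<open>phi\<close> below change the upper edge of a chain, those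
  composed with \<open>phi\<close> above change the lower edge. The chains with edges
  \<open>i, p\<close> and \<open>p, i\<close> belong to the same leaf \<open>i + p - 1\<close>, so
  the path from \<open>i, k\<close> over \<open>i, p\<close> and \<open>p, i\<close> to the base
  chain \<open>p, p\<close> collects the factors \<open>l k\<close>, \<open>l i\<close>,
  \<open>l i\<close>.\<close>

lemma annihilates_nested:
  assumes "1 \<le> i" "i \<le> 4" "1 \<le> k" "k \<le> 4"
  shows "g (graft corolla i (graft corolla k corolla)) =
    l k * (l i)\<^sup>2 * g (graft corolla p (graft corolla p corolla))"
proof -
  have "g (graft corolla i (graft corolla p corolla)) =
      l i * g (graft (graft corolla p corolla) (i + p - 1) corolla)"
    using annihilates_left[of i "i + p - 1"] graft_nested[of p i] assms p by (simp del: graft.simps)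
  also have "graft (graft corolla p corolla) (i + p - 1) corolla =
      graft corolla p (graft corolla i corolla)"
    using graft_nested[of i p] assms p by (simp add: add.commute del: graft.simps)
  also have "g \<dots> = l i * g (graft corolla p (graft corolla p corolla))"
    using annihilates_right[of i p] assms p by (simp del: graft.simps)
  finally show ?thesis
    using annihilates_right[of k i] assms by (simp add: power2_eq_square ac_simps del: graft.simps)
qed

text \<open>Replacing \<open>k\<close> by \<open>p\<close> costs the factor \<open>l k\<close>. As
  \<open>p \<le> i\<close>, leaf \<open>i\<close> of the new quadratic tree lies on its lower node
  at position \<open>i + 1 - p\<close>, so a chain results and its lower edge can be replaced
  too.\<close>

lemma annihilates_parallel:
  assumes "p \<le> i" "i < k" "k \<le> 4"
  shows "g (graft (graft corolla k corolla) i corolla) =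
    l k * l (i + 1 - p) * g (graft corolla p (graft corolla p corolla))"
proof -
  have i: "1 \<le> i + 1 - p" "i + 1 - p \<le> 4" "p + (i + 1 - p) - 1 = i" using assms p by arith+
  have "g (graft (graft corolla k corolla) i corolla) =
      l k * g (graft (graft corolla p corolla) i corolla)"
    using assms p annihilates_left[of k i] by (simp del: graft.simps)
  also have "graft (graft corolla p corolla) i corolla =
      graft corolla p (graft corolla (i + 1 - p) corolla)"
    using graft_nested[of "i + 1 - p" p] i p by (simp del: graft.simps)
  also have "g \<dots> = l (i + 1 - p) * g (graft corolla p (graft corolla p corolla))"
    using i p annihilates_right[of "i + 1 - p" p] by (simp del: graft.simps)
  finally show ?thesis by simp
qed

text \<open>The same tree arises by filling leaf \<open>i\<close> first and then leaf
  \<open>k + 3\<close>; in that description the relation carries the factor \<open>l i\<close>,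
  which is zero before the pivot.\<close>

lemma annihilates_parallel_zero:
  assumes "1 \<le> i" "i < p" "i < k" "k \<le> 4"
  shows "g (graft (graft corolla k corolla) i corolla) = 0"
  using annihilates_left[of i "k + 3"] zero[of i] assms graft_parallel[of i k]
  by (simp del: graft.simps)

lemma annihilates_cubic_trees:
  assumes "g (graft corolla p (graft corolla p corolla)) = 0" "t \<in> cubic_trees"
  shows "g t = 0"
  using assms(2) unfolding cubic_trees_def
proof (elim UnE imageE)
  fix x assume *: "t = (\<lambda>(i, k). graft corolla i (graft corolla k corolla)) x"
    "x \<in> {1..4} \<times> {1..4}"
  obtain i k where x: "x = (i, k)" by fastforce
  show ?thesis
    using * annihilates_nested[of i k] assms(1) unfolding x by (simp del: graft.simps)
next
  fix x assume *: "t = (\<lambda>(i, k). graft (graft corolla k corolla) i corolla) x"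
    "x \<in> {(i, k). 1 \<le> i \<and> i < k \<and> k \<le> 4}"
  obtain i k where x: "x = (i, k)" by fastforce
  show ?thesis
    using * annihilates_parallel[of i k] annihilates_parallel_zero[of i k] assms(1)
    unfolding x by (cases "i < p") (simp_all del: graft.simps)
qed

text \<open>Each chain value can be computed in two ways. Equating the results and cancelling the
  nonzero value at the base chain leaves polynomial equations in \<open>l\<close>.\<close>

lemma coefficients_if_annihilates:
  assumes x: "g (graft corolla p (graft corolla p corolla)) \<noteq> 0"
  shows "minimal_coefficients l"
proof -
  let ?x = "g (graft corolla p (graft corolla p corolla))"
  have nested: "l i * (l k)\<^sup>2 * ?x = l k * g (graft (graft corolla p corolla) (k + i - 1) corolla)"
    if "1 \<le> i" "i \<le> 4" "1 \<le> k" "k \<le> 4" for i k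
    using annihilates_nested[of k i] annihilates_left[of k "k + i - 1"] graft_nested[of i k] that
    by (simp del: graft.simps)
  \<comment> \<open>Leaf \<open>k + 3\<close> lies on the root, to the right of the lower node, so
    this tree is parallel, with lower nodes at leaves \<open>p\<close> and \<open>k\<close> of the
    root.\<close>
  have last: "g (graft (graft corolla p corolla) (k + 3) corolla) = l k * l 1 * ?x"
    if "p < k" "k \<le> 4" for k
    using annihilates_parallel[of p k] graft_parallel[of p k] that p by (simp del: graft.simps)
  consider "p = 1" | "p = 2" | "p = 3" | "p = 4" using p by linarith
  then show ?thesis
  proof cases
    case 1
    \<comment> \<open>For \<open>p = 1\<close>, leaves 1 to 4 of the quadratic tree lie on its lower
      node and leaves 5 to 7 on the root. The facts \<open>low\<close> and \<open>high\<close> treat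
      these two ranges of \<open>k + i - 1\<close>.\<close>
    have first: "g (graft (graft corolla p corolla) j corolla) = l j * ?x" if "1 \<le> j" "j \<le> 4" for j
      using annihilates_right[of j p] graft_nested[of j p] that 1 by (simp del: graft.simps)
    have low: "l i * (l k)\<^sup>2 = l k * l (k + i - 1)" if "1 \<le> i" "1 \<le> k" "k + i \<le> 5" for i k
      using nested[of i k] first[of "k + i - 1"] that x by (simp del: graft.simps)
    have high: "l i * (l k)\<^sup>2 = l k * l (k + i - 4)"
      if "i \<le> 4" "k \<le> 4" "6 \<le> k + i" for i k
      using nested[of i k] last[of "k + i - 4"] that x 1 lp by (simp del: graft.simps)
    have l1: "l 1 = 1" using lp 1 by simp
    have eqs: "(l 2)^3 = l 2 * l 3" "l 3 * (l 2)\<^sup>2 = l 2 * l 4" "(l 3)^3 = l 3 * l 2"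
        "l 2 * (l 3)\<^sup>2 = l 3 * l 4" "(l 4)^3 = (l 4)\<^sup>2" "l 4 * (l 2)\<^sup>2 = (l 2)\<^sup>2"
        "l 4 * (l 3)\<^sup>2 = (l 3)\<^sup>2"
      using low[of 2 2] low[of 3 2] low[of 2 3] high[of 3 3] high[of 4 4] high[of 4 2] high[of 4 3]
      by (simp_all add: power2_eq_square power3_eq_cube)
    show ?thesis
    proof (cases "l 2 = 0")
      case True
      then have "l 3 = 0" "l 4 = 0 \<or> l 4 = 1" using eqs by (auto simp: power2_eq_square power3_eq_cube)
      then show ?thesis using l1 True by (auto simp: minimal_coefficients_def)
    next
      case False
      then have "l 4 = 1" using eqs(6) by simp
      moreover have "l 3 = (l 2)\<^sup>2" using eqs(1) False by (simp add: power2_eq_square power3_eq_cube)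
      moreover from this \<open>l 4 = 1\<close> have cube: "(l 2)^3 = 1"
        using eqs(2) False by (simp add: power2_eq_square power3_eq_cube mult.assoc)
      moreover have "l 2 = 1 \<or> primitive_root_of_unity 6 (- l 2)"
      proof -
        \<comment> \<open>\<open>X^3 - 1 = (X - 1) * (X^2 + X + 1)\<close>, and the quadratic factor
          is the sixth cyclotomic polynomial at \<open>- X\<close>.\<close>
        have "(l 2 - 1) * ((- l 2)\<^sup>2 - (- l 2) + 1) = 0" using cube by algebra
        then show ?thesis by (simp add: primitive_6th_root_iff)
      qed
      moreover have "inverse (l 2) = (l 2)\<^sup>2"
        using cube by (intro inverse_unique) (simp add: power2_eq_square power3_eq_cube mult.assoc)
      ultimately show ?thesis
        using l1 unfolding minimal_coefficients_def
        by (auto intro!: exI[of _ "- l 2"])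
    qed
  next
    case 2
    \<comment> \<open>Leaf 3 of the quadratic tree leads to the base chain, and the other side of
      the equation contains \<open>l 1 = 0\<close>. For \<open>l 4\<close>, leaf 7 leads to a
      parallel tree whose value also contains \<open>l 1\<close>.\<close>
    have "l 3 = 0"
      using nested[of 1 3] zero[of 1] x graft_nested[of 2 2] 2 by (simp del: graft.simps)
    moreover have "l 4 = 0"
      using nested[of 4 4] last[of 4] zero[of 1] x 2 by (simp del: graft.simps)
    ultimately show ?thesis
      using zero[of 1] lp 2 by (simp add: minimal_coefficients_def)
  next
    case 3
    have "l 4 = 0"
      using nested[of 4 4] last[of 4] zero[of 1] x 3 by (simp del: graft.simps)
    then show ?thesis
      using zero[of 1] zero[of 2] lp 3 by (simp add: minimal_coefficients_def)
  next
    case 4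
    then show ?thesis
      using zero[of 1] zero[of 2] zero[of 3] lp by (simp add: minimal_coefficients_def)
  qed
qed

end

text \<open>A chain with upper edge \<open>i\<close> and lower edge \<open>k\<close> has weight
  \<open>(l i)^2 * l k\<close>, as \<open>annihilates_nested\<close> demands; a parallel tree has
  weight \<open>l i * l k\<close>. In each of the seven cases the pivot is known and evaluation
  settles the equations.\<close>

lemma annihilates_weight:
  fixes l :: "nat \<Rightarrow> 'a::field_char_0"
  assumes "minimal_coefficients l" "l p = 1" "p \<in> {1..4}" "\<forall>k. 1 \<le> k \<and> k < p \<longrightarrow> l k = 0"
  shows "annihilates l p (weight l)"
proof -
  have p: "p = 1 \<or> p = 2 \<or> p = 3 \<or> p = 4"
    using assms(3) unfolding atLeastAtMost_1_4 by simp
  have first: "p \<noteq> 1 \<longrightarrow> l 1 = 0" "p \<noteq> 1 \<and> p \<noteq> 2 \<longrightarrow> l 2 = 0" "p = 4 \<longrightarrow> l 3 = 0"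
    using p assms(4)[rule_format, of 1] assms(4)[rule_format, of 2] assms(4)[rule_format, of 3]
    by auto
  consider (e4) "l 1 = 0" "l 2 = 0" "l 3 = 0" "l 4 = 1"
    | (e14) "l 1 = 1" "l 2 = 0" "l 3 = 0" "l 4 = 1"
    | (all) "l 1 = 1" "l 2 = 1" "l 3 = 1" "l 4 = 1"
    | (e3) "l 1 = 0" "l 2 = 0" "l 3 = 1" "l 4 = 0"
    | (e2) "l 1 = 0" "l 2 = 1" "l 3 = 0" "l 4 = 0"
    | (e1) "l 1 = 1" "l 2 = 0" "l 3 = 0" "l 4 = 0"
    | (root) \<alpha> where "primitive_root_of_unity 6 \<alpha>"
      "l 1 = 1" "l 2 = - \<alpha>" "l 3 = - inverse \<alpha>" "l 4 = 1"
    using assms(1) unfolding minimal_coefficients_def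
    by (elim UnE insertE emptyE CollectE exE conjE) auto
  then show ?thesis
  proof cases
    case e4
    then have "p = 4" using p assms(2) by auto
    with e4 show ?thesis
      unfolding annihilates_def atLeastAtMost_1_4 atLeastAtMost_1_7 by simp
  next
    case e14
    then have "p = 1" using first by auto
    with e14 show ?thesis
      unfolding annihilates_def atLeastAtMost_1_4 atLeastAtMost_1_7 by simp
  next
    case all
    then have "p = 1" using first by auto
    with all show ?thesis
      unfolding annihilates_def atLeastAtMost_1_4 atLeastAtMost_1_7 by simp
  next
    case e3
    then have "p = 3" using p assms(2) by auto
    with e3 show ?thesis
      unfolding annihilates_def atLeastAtMost_1_4 atLeastAtMost_1_7 by simp
  next
    case e2
    then have "p = 2" using p assms(2) by auto
    with e2 show ?thesis
      unfolding annihilates_def atLeastAtMost_1_4 atLeastAtMost_1_7 by simp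
  next
    case e1
    then have "p = 1" using first by auto
    with e1 show ?thesis
      unfolding annihilates_def atLeastAtMost_1_4 atLeastAtMost_1_7 by simp
  next
    case root
    then have "p = 1" using first by auto
    \<comment> \<open>Here \<open>l 3 = \<alpha>^2\<close> and \<open>\<alpha>^3 = - 1\<close>; the
      following rules reduce all products of \<open>\<alpha>\<close> and \<open>l 3\<close>.\<close>
    moreover have sq: "\<alpha> * \<alpha> = l 3" and inv: "\<alpha> * l 3 = - 1"
      using root(4) primitive_6th_rootD[OF root(1)] by (simp_all add: right_diff_distrib)
    moreover have "l 3 * \<alpha> = - 1"
      using inv by (simp only: mult.commute)
    moreover have "l 3 * l 3 = \<alpha> * (\<alpha> * l 3)"
      by (simp only: sq[symmetric] mult.assoc)
    then have "l 3 * l 3 = - \<alpha>" unfolding inv by simp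
    ultimately show ?thesis
      using root(2,3,5) unfolding annihilates_def atLeastAtMost_1_4 atLeastAtMost_1_7
      by (simp add: power2_eq_square mult.assoc)
  qed
qed

section \<open>Coefficient vectors of the listed triples\<close>

lemma sum_lookup_phi_comp_phi:
  assumes "j \<in> {1..4}"
  shows "(\<Sum>k\<in>{1..4}. l k * Poly_Mapping.lookup (phi \<circ>[j] phi) (graft corolla k corolla)) = l j"
proof -
  have "(\<Sum>k\<in>{1..4}. l k * Poly_Mapping.lookup (phi \<circ>[j] phi) (graft corolla k corolla)) =
      (\<Sum>k\<in>{1..4}. if j = k then l k else 0)"
    using lookup_phi_comp_phi[OF assms] by (intro sum.cong refl, subst lookup_phi_comp_phi[OF assms]) auto
  then show ?thesis using assms by simp
qed

text \<open>The defining functional of \<open>relations l\<close> is applied to the element. The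
  value \<open>c = 0\<close> serves the monomial relations, \<open>c = - 1\<close> the
  differences.\<close>

lemma coefficients_of_relation:
  assumes "(phi \<circ>[j] phi) + scale c (phi \<circ>[k] phi) \<in> relations l" "j \<in> {1..4}" "k \<in> {1..4}"
  shows "l j + c * l k = 0"
proof -
  let ?F = "\<lambda>f. \<Sum>k\<in>{1..4}. l k * Poly_Mapping.lookup f (graft corolla k corolla)"
  have "?F ((phi \<circ>[j] phi) + scale c (phi \<circ>[k] phi)) = ?F (phi \<circ>[j] phi) + c * ?F (phi \<circ>[k] phi)"
    by (simp only: lookup_add lookup_scale distrib_left sum.distrib sum_distrib_left mult.left_commute)
  then show ?thesis
    using assms(1) unfolding relations_def sum_lookup_phi_comp_phi[OF assms(2)]
      sum_lookup_phi_comp_phi[OF assms(3)] by simp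
qed

text \<open>If \<open>l 4 = 1\<close>, solving for the coefficient at index 4 yields the listed
  generators literally, even where \<open>l 1 = 1\<close> as well; otherwise the only nonzero entry
  is the pivot.\<close>

lemma minimal_triple_if_coefficients:
  fixes l :: "nat \<Rightarrow> 'a::field_char_0"
  assumes "minimal_coefficients l"
  shows "\<exists>T\<in>minimal_triples. relations l = operad.span T"
proof -
  have diff: "{1..4} - {4} = {1, 2, 3::nat}" "{1..4} - {3} = {1, 2, 4::nat}"
    "{1..4} - {2} = {1, 3, 4::nat}" "{1..4} - {1} = {2, 3, 4::nat}"
    by auto
  note span = relations_eq_span[of l 4, unfolded diff image_insert image_empty]
    relations_eq_span[of l 3, unfolded diff image_insert image_empty]
    relations_eq_span[of l 2, unfolded diff image_insert image_empty]
    relations_eq_span[of l 1, unfolded diff image_insert image_empty]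
  consider (plain) "(l 1, l 2, l 3, l 4) \<in>
      {(0, 0, 0, 1), (1, 0, 0, 1), (1, 1, 1, 1), (0, 0, 1, 0), (0, 1, 0, 0), (1, 0, 0, 0)}"
    | (root) \<alpha> where "primitive_root_of_unity 6 \<alpha>"
      "l 1 = 1" "l 2 = - \<alpha>" "l 3 = - inverse \<alpha>" "l 4 = 1"
    using assms unfolding minimal_coefficients_def by auto
  then show ?thesis
  proof cases
    case plain
    then show ?thesis
      using span unfolding minimal_triples_def by (elim insertE emptyE) simp_all
  next
    case root
    let ?T = "{phi \<circ>[1] phi - phi \<circ>[4] phi, phi \<circ>[2] phi + scale \<alpha> (phi \<circ>[4] phi),
      phi \<circ>[3] phi + scale (inverse \<alpha>) (phi \<circ>[4] phi)}"
    have "relations l = operad.span ?T"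
      using span(1) root by simp
    moreover have "?T \<in> minimal_triples"
      unfolding minimal_triples_def by (intro UnI2 CollectI exI[of _ \<alpha>] conjI refl root(1))
    ultimately show ?thesis by (rule bexI)
  qed
qed

text \<open>Each element of \<open>T\<close> gives one linear equation for \<open>l\<close>.
  Together they fix \<open>l\<close> up to a scalar, and the first nonzero entry being 1 fixes the
  scalar.\<close>

lemma coefficients_if_minimal_triple:
  fixes l :: "nat \<Rightarrow> 'a::field_char_0"
  assumes T: "T \<in> minimal_triples" "relations l = operad.span T"
    and p: "l p = 1" "p \<in> {1..4}" "\<forall>k. 1 \<le> k \<and> k < p \<longrightarrow> l k = 0"
  shows "minimal_coefficients l"
proof -
  have sub: "T \<subseteq> relations l" using T(2) operad.span_superset by metis
  have plain: "l j = 0" if "phi \<circ>[j] phi \<in> relations l" "j \<in> {1..4}" for j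
    using coefficients_of_relation[of j 0 j l] that by simp
  have minus: "l j = l k"
    if "phi \<circ>[j] phi - phi \<circ>[k] phi \<in> relations l" "j \<in> {1..4}" "k \<in> {1..4}" for j k
    using coefficients_of_relation[of j "-1" k l] that by simp
  have first: "l 1 = 1 \<or> l 1 = 0 \<and> l 2 = 1 \<or> l 1 = 0 \<and> l 2 = 0 \<and> l 3 = 1 \<or>
      l 1 = 0 \<and> l 2 = 0 \<and> l 3 = 0 \<and> l 4 = 1"
    using p unfolding atLeastAtMost_1_4 by auto
  from T(1) show ?thesis
    unfolding minimal_triples_def
  proof (elim UnE insertE emptyE CollectE exE conjE)
    assume "T = {phi \<circ>[1] phi, phi \<circ>[2] phi, phi \<circ>[3] phi}"
    then have "l 1 = 0" "l 2 = 0" "l 3 = 0" using sub by (auto intro!: plain)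
    then show ?thesis using first by (auto simp: minimal_coefficients_def)
  next
    assume "T = {phi \<circ>[1] phi - phi \<circ>[4] phi, phi \<circ>[2] phi, phi \<circ>[3] phi}"
    then have "l 1 = l 4" "l 2 = 0" "l 3 = 0" using sub by (auto intro!: plain minus)
    then show ?thesis using first by (auto simp: minimal_coefficients_def)
  next
    assume "T = {phi \<circ>[1] phi - phi \<circ>[4] phi, phi \<circ>[2] phi - phi \<circ>[4] phi,
      phi \<circ>[3] phi - phi \<circ>[4] phi}"
    then have "l 1 = l 4" "l 2 = l 4" "l 3 = l 4" using sub by (auto intro!: minus)
    then show ?thesis using first by (auto simp: minimal_coefficients_def)
  next
    assume "T = {phi \<circ>[1] phi, phi \<circ>[2] phi, phi \<circ>[4] phi}"
    then have "l 1 = 0" "l 2 = 0" "l 4 = 0" using sub by (auto intro!: plain)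
    then show ?thesis using first by (auto simp: minimal_coefficients_def)
  next
    assume "T = {phi \<circ>[1] phi, phi \<circ>[3] phi, phi \<circ>[4] phi}"
    then have "l 1 = 0" "l 3 = 0" "l 4 = 0" using sub by (auto intro!: plain)
    then show ?thesis using first by (auto simp: minimal_coefficients_def)
  next
    assume "T = {phi \<circ>[2] phi, phi \<circ>[3] phi, phi \<circ>[4] phi}"
    then have "l 2 = 0" "l 3 = 0" "l 4 = 0" using sub by (auto intro!: plain)
    then show ?thesis using first by (auto simp: minimal_coefficients_def)
  next
    fix \<alpha> :: 'a
    assume root: "primitive_root_of_unity 6 \<alpha>"
      and "T = {phi \<circ>[1] phi - phi \<circ>[4] phi, phi \<circ>[2] phi + scale \<alpha> (phi \<circ>[4] phi),
        phi \<circ>[3] phi + scale (inverse \<alpha>) (phi \<circ>[4] phi)}"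
    then have "l 1 = l 4" "l 2 + \<alpha> * l 4 = 0" "l 3 + inverse \<alpha> * l 4 = 0"
      using sub by (auto intro!: minus coefficients_of_relation)
    then have "l 1 = 1" "l 2 = - \<alpha>" "l 3 = - inverse \<alpha>" "l 4 = 1"
      using first by (auto simp: eq_neg_iff_add_eq_0)
    then show ?thesis using root by (auto simp: minimal_coefficients_def)
  qed
qed

section \<open>The rank of the cubic consequences\<close>

lemma functional_on_monomials:
  fixes g :: "tree \<Rightarrow> 'a::field"
  obtains f where "Vector_Spaces.linear scale (*) f" "\<And>t. f (monomial t) = g t"
proof -
  interpret vector_space_pair scale "(*) :: 'a \<Rightarrow> 'a \<Rightarrow> 'a"
    by (intro vector_space_pair.intro operad.vector_space_axioms vector_space_mult)
  obtain f where "Vector_Spaces.linear scale (*) f"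
    "\<forall>w\<in>range monomial. f w = g (inv monomial w)"
    using linear_independent_extend[OF independent_monomials, of UNIV "\<lambda>w. g (inv monomial w)"]
    by metis
  then show ?thesis using that[of f] by (simp add: inv_f_f[OF inj_monomial])
qed

lemma component_10:
  "component 10 = operad.span (monomial ` cubic_trees :: (tree \<Rightarrow>\<^sub>0 'a::field) set)"
  unfolding component_eq_span leaves_10 ..

lemma card_cubic_monomials: "card (monomial ` cubic_trees :: (tree \<Rightarrow>\<^sub>0 'a::field) set) = 22"
  using card_image[OF inj_on_subset[OF inj_monomial subset_UNIV]] card_cubic_trees by metis

text \<open>With \<open>l p = 1\<close> the value at the base chain is 1, so the functional given by
  \<open>weight\<close> is nonzero.\<close>

lemma weight_nested: "p \<in> {1..4} \<Longrightarrow> weight l (graft corolla p (graft corolla p corolla)) = l p ^ 3"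
  unfolding atLeastAtMost_1_4
  by (elim insertE emptyE) (simp_all add: power2_eq_square power3_eq_cube)

text \<open>A functional vanishing on \<open>C\<close> is determined by its value at the base chain,
  so \<open>C\<close> has codimension at most one. If \<open>l\<close> is minimal,
  \<open>weight\<close> shows that \<open>C\<close> is proper; conversely a functional showing this
  makes \<open>l\<close> minimal.\<close>

lemma dim_cubic_consequences:
  fixes l :: "nat \<Rightarrow> 'a::field_char_0"
  assumes p: "l p = 1" "p \<in> {1..4}" "\<forall>k. 1 \<le> k \<and> k < p \<longrightarrow> l k = 0"
  defines "C \<equiv> operad.span (cubic_consequences (relations l))"
  shows "minimal_coefficients l \<Longrightarrow> operad.dim C = 21"
    and "\<not> minimal_coefficients l \<Longrightarrow> C = component 10"
proof -
  let ?W = "monomial ` cubic_trees :: (tree \<Rightarrow>\<^sub>0 'a) set"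
  let ?v = "monomial (graft corolla p (graft corolla p corolla)) :: tree \<Rightarrow>\<^sub>0 'a"
  have W: "finite ?W" "card ?W = 22" "operad.span ?W = component 10" "operad.independent ?W"
    using finite_cubic_trees card_cubic_monomials component_10 independent_monomials by auto
  have C: "operad.subspace C" "C \<subseteq> component 10"
    unfolding C_def
    by (simp, intro operad.span_minimal cubic_consequences_in_component subspace_component)
      (auto simp only: relations_def)
  have v: "?v \<in> component 10"
    using p(2) by (simp add: monomial_in_component leaves_graft del: graft.simps)
  have p': "1 \<le> p" "p \<le> 4" "\<And>k. 1 \<le> k \<Longrightarrow> k < p \<Longrightarrow> l k = 0" using p by auto
  have ann: "annihilates l p (\<lambda>t. f (monomial t)) \<longleftrightarrow> (\<forall>w\<in>cubic_consequences (relations l). f w = 0)"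
    if "Vector_Spaces.linear scale (*) f" for f :: "(tree \<Rightarrow>\<^sub>0 'a) \<Rightarrow> 'a"
    unfolding vanishes_on_consequences_iff[of f l p, OF that p(1,2)] annihilates_def ..
  \<comment> \<open>A functional separating \<open>w\<close> from \<open>C\<close> and the base
    chain annihilates all consequences and is zero at the base chain, hence at every cubic
    tree.\<close>
  have W_span: "w \<in> operad.span (insert ?v C)" if "w \<in> ?W" for w
  proof (rule ccontr)
    assume "w \<notin> operad.span (insert ?v C)"
    from separating_functional[OF this] obtain f where f: "Vector_Spaces.linear scale (*) f"
      "\<And>u. u \<in> operad.span (insert ?v C) \<Longrightarrow> f u = 0" "f w = 1"
      by metis
    have "f u = 0" if "u \<in> cubic_consequences (relations l)" for u
      using that f(2) unfolding C_def by (simp add: operad.span_base)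
    then have "annihilates l p (\<lambda>t. f (monomial t))" using ann[OF f(1)] by blast
    moreover have "f ?v = 0" by (intro f(2) operad.span_base) simp
    ultimately have "f w = 0"
      using annihilates_cubic_trees[of l p "\<lambda>t. f (monomial t)"] p(1) p' that by blast
    then show False using f(3) by simp
  qed
  then have ge: "22 \<le> Suc (operad.dim C)"
    using card_le_Suc_dim[OF W(4,1), of C ?v] W(2,3) C(2) by auto
  show "operad.dim C = 21" if min: "minimal_coefficients l"
  proof -
    obtain f where f: "Vector_Spaces.linear scale (*) f" "\<And>t. f (monomial t) = weight l t"
  by (rule functional_on_monomials[of "weight l"]) (rule that)
    interpret f: Vector_Spaces.linear scale "(*)" f by (rule f(1))
    have "\<forall>w\<in>cubic_consequences (relations l). f w = 0"
      using ann[OF f(1)] annihilates_weight[of l p, OF min p] unfolding f(2) by blast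
    then have "f w = 0" if "w \<in> C" for w
      using f.eq_0_on_span that unfolding C_def by blast
    moreover have "f ?v = 1"
      unfolding f(2) weight_nested[OF p(2)] p(1) by simp
    ultimately have "?v \<notin> C" by force
    then show ?thesis
      using dim_less_card[OF C(1) _ W(1), of ?v] W(2,3) C(2) v ge by simp
  qed
  show "C = component 10" if not_min: "\<not> minimal_coefficients l"
  proof (rule ccontr)
    assume "C \<noteq> component 10"
    then obtain w where w: "w \<in> component 10" "w \<notin> C" using C(2) by blast
    then have "w \<notin> operad.span (cubic_consequences (relations l))" unfolding C_def by simp
    from separating_functional[OF this] obtain f where f: "Vector_Spaces.linear scale (*) f"
      "\<And>u. u \<in> C \<Longrightarrow> f u = 0" "f w = 1"
      unfolding C_def by metis
    interpret f: Vector_Spaces.linear scale "(*)" f by (rule f(1))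
    have "f u = 0" if "u \<in> cubic_consequences (relations l)" for u
      using that f(2) unfolding C_def by (simp add: operad.span_base)
    then have annf: "annihilates l p (\<lambda>t. f (monomial t))" using ann[OF f(1)] by blast
    have "f ?v = 0"
      using coefficients_if_annihilates[of l p "\<lambda>t. f (monomial t)", OF annf p(1) p'] not_min by blast
    then have "f u = 0" if "u \<in> ?W" for u
      using annihilates_cubic_trees[of l p "\<lambda>t. f (monomial t)", OF annf p(1) p'] that by blast
    then have "f w = 0" using f.eq_0_on_span w(1) unfolding W(3)[symmetric] by blast
    then show False using f(3) by simp
  qed
qed

section \<open>The quotient operad and the classification\<close>

lemma zero_in_quotient_iff:
  assumes "operad.subspace (J (leaves t))"
  shows "zero_in_quotient J t \<longleftrightarrow> monomial t \<in> J (leaves t)"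
proof
  assume "zero_in_quotient J t"
  moreover have "0 \<in> quotient_class J (leaves t) 0"
    using operad.subspace_0[OF assms] operad.subspace_0[OF subspace_component]
    by (simp add: quotient_class_def)
  ultimately have "0 \<in> quotient_class J (leaves t) (monomial t)"
    unfolding zero_in_quotient_def by simp
  then have "- monomial t \<in> J (leaves t)"
    by (simp add: quotient_class_def)
  then show "monomial t \<in> J (leaves t)"
    using operad.subspace_neg[OF assms] by fastforce
next
  assume t: "monomial t \<in> J (leaves t)"
  have "g - monomial t \<in> J (leaves t) \<longleftrightarrow> g - 0 \<in> J (leaves t)" for g
    using operad.subspace_add[OF assms _ t, of "g - monomial t"] operad.subspace_diff[OF assms _ t, of g]
    by auto
  then show "zero_in_quotient J t" by (simp add: zero_in_quotient_def quotient_class_def)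
qed

theorem theorem5p6:
  fixes R :: "(tree \<Rightarrow>\<^sub>0 'a::{alg_closed_field, field_char_0}) set"
  assumes "operad.subspace R" and "R \<subseteq> component 7" and "operad.dim R = 3"
  shows "operad.dim (generated_ideal R 10) \<in> {21, 22} \<and>
    (operad.dim (generated_ideal R 10) = 21 \<longleftrightarrow>
      (\<exists>T\<in>minimal_triples. R = operad.span T)) \<and>
    ((\<nexists>T. T \<in> minimal_triples \<and> R = operad.span T) \<longrightarrow>
      operad.dim (generated_ideal R 10) = 22 \<and>
      quotient_nilpotent_of_index (generated_ideal R) 3)"
proof -
  obtain l p where lp: "p \<in> {1..4}" "l p = 1" "\<forall>k. 1 \<le> k \<and> k < p \<longrightarrow> l k = 0"
    and R: "R = relations l"
    using subspace_eq_relations[OF assms] by metis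
  have I10: "generated_ideal R 10 = operad.span (cubic_consequences (relations l))"
    using generated_ideal_10[OF assms(1,2)] unfolding R .
  have min_iff: "(\<exists>T\<in>minimal_triples. R = operad.span T) \<longleftrightarrow> minimal_coefficients l"
    using minimal_triple_if_coefficients[of l] coefficients_if_minimal_triple[of _ l p] lp
    unfolding R by blast
  have dim10: "operad.dim (component 10 :: (tree \<Rightarrow>\<^sub>0 'a) set) = 22"
    unfolding component_10 operad.dim_span_eq_card_independent[OF independent_monomials]
    by (rule card_cubic_monomials)
  have nilpotent: "quotient_nilpotent_of_index (generated_ideal R) 3"
    if full: "generated_ideal R 10 = component 10"
  proof -
    have "zero_in_quotient (generated_ideal R) t" if "nodes t = 3" for t
    proof -
      have "leaves t = 10" using that by (simp add: leaves_eq_nodes)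
      moreover have "operad.subspace (generated_ideal R (leaves t))"
        unfolding \<open>leaves t = 10\<close> full by (rule subspace_component)
      ultimately show ?thesis
        using zero_in_quotient_iff[of "generated_ideal R" t] full
        by (simp add: monomial_in_component)
    qed
    moreover have "\<not> (\<forall>t. nodes t = 2 \<longrightarrow> zero_in_quotient (generated_ideal R) t)"
    proof
      assume *: "\<forall>t. nodes t = 2 \<longrightarrow> zero_in_quotient (generated_ideal R) t"
      \<comment> \<open>The quadratic tree at the pivot survives in the quotient: its membership in
        \<open>relations l\<close> would force \<open>l p = 0\<close>.\<close>
      have "phi \<circ>[p] phi \<in> R"
      proof -
        have "nodes (graft corolla p corolla) = 2" "leaves (graft corolla p corolla) = 7"
          using lp(1) by (simp_all add: nodes_graft leaves_graft del: graft.simps)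
        then show ?thesis
          using * zero_in_quotient_iff[of "generated_ideal R" "graft corolla p corolla"]
            generated_ideal_7[OF assms(1,2)] assms(1)
          by (simp add: phi_comp_phi del: graft.simps)
      qed
      then show False
        using coefficients_of_relation[of p 0 p l] lp(1,2) unfolding R by simp
    qed
    ultimately show ?thesis by (simp add: quotient_nilpotent_of_index_def)
  qed
  show ?thesis
  proof (cases "minimal_coefficients l")
    case True
    then have "operad.dim (generated_ideal R 10) = 21"
      unfolding I10 by (rule dim_cubic_consequences(1)[OF lp(2,1,3)])
    then show ?thesis using True min_iff by auto
  next
    case False
    then have "generated_ideal R 10 = component 10"
      unfolding I10 by (rule dim_cubic_consequences(2)[OF lp(2,1,3)])
    then show ?thesis using False min_iff dim10 nilpotent by auto
  qed
qed

end
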